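(* Let $p\in[1,\infty]$. There is no constant $K>0$ such that $$\|f(A_1,B_1,C_1)-f(A_2,B_2,C_2)\|_{\boldsymbol S_p}\le K\,\|f\|_{B_{\infty,1}^1(\mathbb R^3)}\max\big\{\|A_1-A_2\|_{\boldsymbol S_p},\ \|B_1-B_2\|_{\boldsymbol S_p},\ \|C_1-C_2\|_{\boldsymbol S_p}\big\}$$ for all triples $(A_1,B_1,C_1)$ and $(A_2,B_2,C_2)$ of not necessarily commuting finite rank self-adjoint operators (all six acting on the same Hilbert space) and all functions $f$ in $B_{\infty,1}^1(\mathbb R^3)$.
   Context: Operators act on complex Hilbert spaces. $\boldsymbol S_p$ is the Schatten--von Neumann class with its usual norm; for $p=\infty$ the norm is the operator norm. Functions of noncommuting triples. For self-adjoint operators $A,B,C$ of finite rank (or, more generally, with finite spectra) and any function $f:\mathbb R^3\to\mathbb C$, $$f(A,B,C)=\sum_{\lambda\in\sigma(A),\,\mu\in\sigma(B),\,\nu\in\sigma(C)}f(\lambda,\mu,\nu)\,E_A(\{\lambda\})E_B(\{\mu\})E_C(\{\nu\}),$$ where $E_A,E_B,E_C$ are the spectral measures of $A,B,C$, so that $E_A(\{\lambda\})$ is the orthogonal projection onto $\ker(A-\lambda I)$, etc. Besov class $B_{\infty,1}^1(\mathbb R^d)$. Fix an infinitely differentiable function $w\ge0$ on $\mathbb R$ with $\operatorname{supp}w\subset[\frac12,2]$ and $w(s)=1-w(s/2)$ for $s\in[1,2]$. Define $W_n$, $n\in\mathbb Z$, on $\mathbb R^d$ by $(\mathcal F W_n)(x)=w(\|x\|_2/2^n)$,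 where $\|\cdot\|_2$ is the Euclidean norm and $(\mathcal F g)(t)=\int_{\mathbb R^d}g(x)e^{-\mathrm i(x,t)}\,dx$. For a tempered distribution $f$ put $f_n=f*W_n$. Then $f\in B_{\infty,1}^1(\mathbb R^d)$ if $$\|f\|_{B_{\infty,1}^1(\mathbb R^d)}:=\sum_{n\in\mathbb Z}2^n\|f_n\|_{L^\infty(\mathbb R^d)}<\infty$$ and $\frac{\partial f}{\partial x_j}=\sum_{n\in\mathbb Z}\frac{\partial f_n}{\partial x_j}$, $1\le j\le d$, with convergence in the space of tempered distributions $\mathscr S'(\mathbb R^d)$ (weak-$*$ topology). Elements of $B_{\infty,1}^1(\mathbb R^d)$ are identified with their continuous representatives, so they can be evaluated pointwise. *)

theory Defs
  imports "HOL-Analysis.Analysis" "HOL-Probability.Essential_Supremum"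
begin

section \<open>Complex Hilbert spaces\<close>

class chilbert_space = banach +
  fixes scaleC :: "complex \<Rightarrow> 'a \<Rightarrow> 'a"  (infixr "*\<^sub>C" 75)
    and cinner :: "'a \<Rightarrow> 'a \<Rightarrow> complex"
  assumes scaleC_add_right: "c *\<^sub>C (x + y) = c *\<^sub>C x + c *\<^sub>C y"
    and scaleC_add_left: "(c + d) *\<^sub>C x = c *\<^sub>C x + d *\<^sub>C x"
    and scaleC_scaleC: "c *\<^sub>C (d *\<^sub>C x) = (c * d) *\<^sub>C x"
    and scaleR_scaleC: "r *\<^sub>R x = complex_of_real r *\<^sub>C x"
    and cinner_commute: "cinner x y = cnj (cinner y x)"
    and cinner_add_left: "cinner (x + y) z = cinner x z + cinner y z"
    and cinner_scaleC_left: "cinner (c *\<^sub>C x) y = c * cinner x y"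
    and cinner_self: "cinner x x = complex_of_real ((norm x)\<^sup>2)"

text \<open>The complex linear span is \<open>complex_vector.span\<close>; the unqualified \<open>span\<close> is the real one.\<close>

global_interpretation complex_vector:
  vector_space "scaleC :: complex \<Rightarrow> 'a \<Rightarrow> 'a::chilbert_space"
proof
  show "1 *\<^sub>C x = x" for x :: 'a
    using scaleR_scaleC[of 1 x] by simp
qed (simp_all add: scaleC_add_right scaleC_add_left scaleC_scaleC)

definition infinite_dimensional :: "'h::chilbert_space itself \<Rightarrow> bool" where
  "infinite_dimensional _ \<longleftrightarrow> \<not> (\<exists>S::'h set. finite S \<and> complex_vector.span S = UNIV)"


subsection \<open>Example: square-summable sequences\<close>

text \<open>The instance shows that infinite-dimensional types in \<open>chilbert_space\<close> exist.\<close>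

typedef ell2 = "{x :: nat \<Rightarrow> complex. summable (\<lambda>n. (norm (x n))\<^sup>2)}"
  morphisms ell2_nth Abs_ell2
  by (rule exI[of _ "\<lambda>_. 0"]) simp

setup_lifting type_definition_ell2

lemma ell2_add_bound:
  fixes x y :: "nat \<Rightarrow> complex"
  shows "(norm (x n + y n))\<^sup>2 \<le> 2 * (norm (x n))\<^sup>2 + 2 * (norm (y n))\<^sup>2"
proof -
  have "(norm (x n + y n))\<^sup>2 \<le> (norm (x n) + norm (y n))\<^sup>2"
    by (intro power_mono norm_triangle_ineq) auto
  also have "\<dots> \<le> 2 * (norm (x n))\<^sup>2 + 2 * (norm (y n))\<^sup>2"
    using sum_squares_bound[of "norm (x n)" "norm (y n)"] by (simp add: power2_sum)
  finally show ?thesis .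
qed

lemma ell2_summable_add:
  fixes x y :: "nat \<Rightarrow> complex"
  assumes "summable (\<lambda>n. (norm (x n))\<^sup>2)" "summable (\<lambda>n. (norm (y n))\<^sup>2)"
  shows "summable (\<lambda>n. (norm (x n + y n))\<^sup>2)"
  by (rule summable_comparison_test'[where g = "\<lambda>n. 2 * (norm (x n))\<^sup>2 + 2 * (norm (y n))\<^sup>2"])
    (auto intro!: summable_add summable_mult assms ell2_add_bound)

lemma ell2_summable_inner:
  fixes x y :: "nat \<Rightarrow> complex"
  assumes "summable (\<lambda>n. (norm (x n))\<^sup>2)" "summable (\<lambda>n. (norm (y n))\<^sup>2)"
  shows "summable (\<lambda>n. x n * cnj (y n))"
proof (rule summable_comparison_test'[where g = "\<lambda>n. (norm (x n))\<^sup>2 + (norm (y n))\<^sup>2"])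
  fix n
  have "2 * norm (x n) * norm (y n) \<le> (norm (x n))\<^sup>2 + (norm (y n))\<^sup>2"
    by (rule sum_squares_bound)
  moreover have "0 \<le> norm (x n) * norm (y n)" by simp
  ultimately show "norm (x n * cnj (y n)) \<le> (norm (x n))\<^sup>2 + (norm (y n))\<^sup>2"
    unfolding norm_mult complex_mod_cnj by linarith
qed (intro summable_add assms)

instantiation ell2 :: real_normed_vector
begin

lift_definition zero_ell2 :: ell2 is "\<lambda>_. 0" by simp
lift_definition plus_ell2 :: "ell2 \<Rightarrow> ell2 \<Rightarrow> ell2" is "\<lambda>x y n. x n + y n"
  by (rule ell2_summable_add)
lift_definition uminus_ell2 :: "ell2 \<Rightarrow> ell2" is "\<lambda>x n. - x n" by simp
lift_definition minus_ell2 :: "ell2 \<Rightarrow> ell2 \<Rightarrow> ell2" is "\<lambda>x y n. x n - y n"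
  using ell2_summable_add[where y = "\<lambda>n. - _ n"] by simp
lift_definition scaleR_ell2 :: "real \<Rightarrow> ell2 \<Rightarrow> ell2" is "\<lambda>r x n. r *\<^sub>R x n"
  by (simp add: power_mult_distrib summable_mult)
lift_definition norm_ell2 :: "ell2 \<Rightarrow> real" is "\<lambda>x. sqrt (\<Sum>n. (norm (x n))\<^sup>2)" .
definition "sgn_ell2 (x :: ell2) = scaleR (inverse (norm x)) x"
definition "dist_ell2 (x :: ell2) y = norm (x - y)"
definition "(uniformity :: (ell2 \<times> ell2) filter) = (INF e\<in>{0 <..}. principal {(x :: ell2, y). dist x y < e})"
definition "open_ell2 (S :: ell2 set) \<longleftrightarrow> (\<forall>x\<in>S. \<forall>\<^sub>F (x', y) in uniformity. x' = x \<longrightarrow> y \<in> S)"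

instance
proof
  fix x y z :: ell2 and a b :: real
  show "x + y + z = x + (y + z)" "x + y = y + x" "0 + x = x" "- x + x = 0" "x - y = x + - y"
    by (transfer; simp add: algebra_simps)+
  show "a *\<^sub>R (x + y) = a *\<^sub>R x + a *\<^sub>R y" "(a + b) *\<^sub>R x = a *\<^sub>R x + b *\<^sub>R x"
    "a *\<^sub>R b *\<^sub>R x = (a * b) *\<^sub>R x" "1 *\<^sub>R x = x"
    by (transfer; simp add: algebra_simps)+
  show "norm x = 0 \<longleftrightarrow> x = 0"
  proof transfer
    fix x :: "nat \<Rightarrow> complex" assume "summable (\<lambda>n. (norm (x n))\<^sup>2)"
    then show "sqrt (\<Sum>n. (norm (x n))\<^sup>2) = 0 \<longleftrightarrow> x = (\<lambda>_. 0)"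
      using suminf_eq_zero_iff[of "\<lambda>n. (norm (x n))\<^sup>2"] by (auto simp: fun_eq_iff)
  qed
  show "norm (a *\<^sub>R x) = \<bar>a\<bar> * norm x"
    by transfer (simp add: power_mult_distrib suminf_mult real_sqrt_mult)
  show "norm (x + y) \<le> norm x + norm y"
  proof transfer
    fix x y :: "nat \<Rightarrow> complex"
    assume x: "summable (\<lambda>n. (norm (x n))\<^sup>2)" and y: "summable (\<lambda>n. (norm (y n))\<^sup>2)"
    let ?S = "\<lambda>x :: nat \<Rightarrow> complex. \<Sum>n. (norm (x n))\<^sup>2"
    have L: "L2_set (\<lambda>n. norm (x n)) {..<m} \<le> sqrt (?S x)"
      if "summable (\<lambda>n. (norm (x n))\<^sup>2)" for m and x :: "nat \<Rightarrow> complex"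
      unfolding L2_set_def by (intro real_sqrt_le_mono sum_le_suminf that) auto
    have "?S (\<lambda>n. x n + y n) \<le> (sqrt (?S x) + sqrt (?S y))\<^sup>2"
    proof (rule suminf_le_const[OF ell2_summable_add[OF x y]])
      fix m
      have "L2_set (\<lambda>n. norm (x n + y n)) {..<m} \<le> L2_set (\<lambda>n. norm (x n) + norm (y n)) {..<m}"
        by (intro L2_set_mono norm_triangle_ineq) auto
      also have "\<dots> \<le> L2_set (\<lambda>n. norm (x n)) {..<m} + L2_set (\<lambda>n. norm (y n)) {..<m}"
        by (rule L2_set_triangle_ineq)
      also have "\<dots> \<le> sqrt (?S x) + sqrt (?S y)"
        by (intro add_mono L x y)
      finally show "(\<Sum>n<m. (norm (x n + y n))\<^sup>2) \<le> (sqrt (?S x) + sqrt (?S y))\<^sup>2"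
        unfolding L2_set_def by (rule sqrt_le_D)
    qed
    then show "sqrt (?S (\<lambda>n. x n + y n)) \<le> sqrt (?S x) + sqrt (?S y)"
      by (intro real_le_lsqrt add_nonneg_nonneg real_sqrt_ge_zero suminf_nonneg x y) auto
  qed
qed (rule sgn_ell2_def dist_ell2_def uniformity_ell2_def open_ell2_def)+

end

instance ell2 :: banach
proof
  fix X :: "nat \<Rightarrow> ell2"
  assume X: "Cauchy X"
  have nth_le: "norm (ell2_nth x n) \<le> norm x" for x n
  proof transfer
    fix x :: "nat \<Rightarrow> complex" and n
    assume "summable (\<lambda>n. (norm (x n))\<^sup>2)"
    then have "(\<Sum>k\<in>{n}. (norm (x k))\<^sup>2) \<le> (\<Sum>n. (norm (x n))\<^sup>2)"
      by (intro sum_le_suminf) auto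
    then show "norm (x n) \<le> sqrt (\<Sum>n. (norm (x n))\<^sup>2)"
      by (intro real_le_rsqrt) simp
  qed
  have "Cauchy (\<lambda>m. ell2_nth (X m) n)" for n
    unfolding Cauchy_iff
  proof (intro allI impI)
    fix e :: real assume "0 < e"
    then obtain M where M: "\<And>m k. m \<ge> M \<Longrightarrow> k \<ge> M \<Longrightarrow> norm (X m - X k) < e"
      using X unfolding Cauchy_iff by blast
    have "norm (ell2_nth (X m) n - ell2_nth (X k) n) < e" if "m \<ge> M" "k \<ge> M" for m k
      using nth_le[of "X m - X k" n] M[OF that] by (simp add: minus_ell2.rep_eq)
    then show "\<exists>M. \<forall>m\<ge>M. \<forall>k\<ge>M. norm (ell2_nth (X m) n - ell2_nth (X k) n) < e"
      by blast
  qed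
  then obtain y where y: "\<And>n. (\<lambda>m. ell2_nth (X m) n) \<longlonglongrightarrow> y n"
    unfolding Cauchy_convergent_iff convergent_def by metis
  have *: "\<exists>M. \<forall>m\<ge>M. \<forall>N. (\<Sum>n<N. (norm (ell2_nth (X m) n - y n))\<^sup>2) \<le> e\<^sup>2" if e: "0 < e" for e
  proof -
    obtain M where M: "\<And>m k. m \<ge> M \<Longrightarrow> k \<ge> M \<Longrightarrow> norm (X m - X k) < e"
      using X e unfolding Cauchy_iff by blast
    have fin: "(\<Sum>n<N. (norm (ell2_nth (X m) n - ell2_nth (X k) n))\<^sup>2) \<le> e\<^sup>2"
      if mk: "m \<ge> M" "k \<ge> M" for m k N
    proof -
      have "summable (\<lambda>n. (norm (ell2_nth (X m - X k) n))\<^sup>2)"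
        using ell2_nth[of "X m - X k"] by simp
      then have "(\<Sum>n<N. (norm (ell2_nth (X m - X k) n))\<^sup>2) \<le> (\<Sum>n. (norm (ell2_nth (X m - X k) n))\<^sup>2)"
        by (intro sum_le_suminf) auto
      also have "\<dots> \<le> e\<^sup>2"
        using M[OF mk] unfolding norm_ell2.rep_eq by (intro sqrt_le_D) simp
      finally show ?thesis by (simp add: minus_ell2.rep_eq)
    qed
    have "(\<Sum>n<N. (norm (ell2_nth (X m) n - y n))\<^sup>2) \<le> e\<^sup>2" if m: "m \<ge> M" for m N
    proof (rule LIMSEQ_le_const2)
      show "(\<lambda>k. \<Sum>n<N. (norm (ell2_nth (X m) n - ell2_nth (X k) n))\<^sup>2)
              \<longlonglongrightarrow> (\<Sum>n<N. (norm (ell2_nth (X m) n - y n))\<^sup>2)"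
        by (intro tendsto_intros y)
      show "\<exists>K. \<forall>k\<ge>K. (\<Sum>n<N. (norm (ell2_nth (X m) n - ell2_nth (X k) n))\<^sup>2) \<le> e\<^sup>2"
        using fin[OF m] by blast
    qed
    then show ?thesis by blast
  qed
  have diff: "summable (\<lambda>n. (norm (ell2_nth (X m) n - y n))\<^sup>2)"
    if "\<forall>N. (\<Sum>n<N. (norm (ell2_nth (X m) n - y n))\<^sup>2) \<le> e\<^sup>2" for m e
    by (rule bounded_imp_summable[where B = "e\<^sup>2"])
      (use that in \<open>auto simp: lessThan_Suc_atMost[symmetric] simp del: sum.lessThan_Suc\<close>)
  obtain M where M: "\<forall>N. (\<Sum>n<N. (norm (ell2_nth (X M) n - y n))\<^sup>2) \<le> 1\<^sup>2"
    using *[of 1] by auto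
  have "summable (\<lambda>n. (norm (ell2_nth (X M) n + - (ell2_nth (X M) n - y n)))\<^sup>2)"
    by (rule ell2_summable_add) (use ell2_nth[of "X M"] diff[OF M] in
      \<open>simp_all add: norm_minus_commute\<close>)
  then have sy: "summable (\<lambda>n. (norm (y n))\<^sup>2)" by simp
  have "X \<longlonglongrightarrow> Abs_ell2 y"
  proof (rule LIMSEQ_I)
    fix r :: real assume r: "0 < r"
    then obtain M where M: "\<And>m. m \<ge> M \<Longrightarrow> \<forall>N. (\<Sum>n<N. (norm (ell2_nth (X m) n - y n))\<^sup>2) \<le> (r/2)\<^sup>2"
      using *[of "r/2"] by auto
    have "norm (X m - Abs_ell2 y) < r" if m: "m \<ge> M" for m
    proof -
      have "(\<Sum>n. (norm (ell2_nth (X m) n - y n))\<^sup>2) \<le> (r/2)\<^sup>2"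
        using M[OF m] by (intro suminf_le_const diff[OF M[OF m]]) auto
      then have "norm (X m - Abs_ell2 y) \<le> r/2"
        unfolding norm_ell2.rep_eq minus_ell2.rep_eq using r sy
        by (intro real_le_lsqrt) (simp_all add: Abs_ell2_inverse)
      then show ?thesis using r by simp
    qed
    then show "\<exists>M. \<forall>m\<ge>M. norm (X m - Abs_ell2 y) < r" by blast
  qed
  then show "convergent X" by (rule convergentI)
qed

instantiation ell2 :: chilbert_space
begin

lift_definition scaleC_ell2 :: "complex \<Rightarrow> ell2 \<Rightarrow> ell2" is "\<lambda>c x n. c * x n"
  by (simp add: norm_mult power_mult_distrib summable_mult)
lift_definition cinner_ell2 :: "ell2 \<Rightarrow> ell2 \<Rightarrow> complex" is "\<lambda>x y. \<Sum>n. x n * cnj (y n)" .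

instance
proof
  fix x y z :: ell2 and c d :: complex and r :: real
  show "c *\<^sub>C (x + y) = c *\<^sub>C x + c *\<^sub>C y" "(c + d) *\<^sub>C x = c *\<^sub>C x + d *\<^sub>C x"
    "c *\<^sub>C (d *\<^sub>C x) = (c * d) *\<^sub>C x"
    by (transfer; simp add: algebra_simps)+
  show "r *\<^sub>R x = complex_of_real r *\<^sub>C x"
    by transfer (simp add: scaleR_conv_of_real)
  show "cinner x y = cnj (cinner y x)"
  proof transfer
    fix x y :: "nat \<Rightarrow> complex"
    assume x: "summable (\<lambda>n. (norm (x n))\<^sup>2)" and y: "summable (\<lambda>n. (norm (y n))\<^sup>2)"
    have "(\<lambda>n. cnj (y n * cnj (x n))) sums cnj (\<Sum>n. y n * cnj (x n))"
      unfolding sums_cnj by (rule summable_sums[OF ell2_summable_inner[OF y x]])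
    then show "(\<Sum>n. x n * cnj (y n)) = cnj (\<Sum>n. y n * cnj (x n))"
      by (simp add: sums_iff mult.commute)
  qed
  show "cinner (x + y) z = cinner x z + cinner y z"
    by transfer (simp add: suminf_add ell2_summable_inner ring_distribs)
  show "cinner (c *\<^sub>C x) y = c * cinner x y"
    by transfer (simp add: suminf_mult[symmetric] ell2_summable_inner mult.assoc)
  show "cinner x x = complex_of_real ((norm x)\<^sup>2)"
    by transfer (simp add: suminf_nonneg suminf_of_real complex_norm_square[symmetric] power2_eq_square[symmetric] del: of_real_power)
qed

end

lemma infinite_dimensional_ell2: "infinite_dimensional TYPE(ell2)"
  unfolding infinite_dimensional_def
proof
  define e where "e k = Abs_ell2 (\<lambda>n. if n = k then 1 else 0)" for k
  have e: "ell2_nth (e k) n = (if n = k then 1 else 0)" for k n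
    unfolding e_def by (subst Abs_ell2_inverse)
      (auto intro!: summable_finite[of "{k}"] split: if_splits)
  have nth_sum: "ell2_nth (\<Sum>v\<in>t. u v *\<^sub>C v) n = (\<Sum>v\<in>t. u v * ell2_nth v n)" for t u n
    by (induction t rule: infinite_finite_induct)
      (simp_all add: zero_ell2.rep_eq plus_ell2.rep_eq scaleC_ell2.rep_eq)
  have inj: "inj e"
    by (rule injI) (metis e zero_neq_one)
  have "complex_vector.independent (range e)"
    unfolding complex_vector.independent_explicit_module
  proof (intro allI impI)
    fix t u v
    assume t: "finite t" "t \<subseteq> range e" "(\<Sum>v\<in>t. u v *\<^sub>C v) = 0" and v: "v \<in> t"
    then obtain k where k: "v = e k" by auto
    have "0 = (\<Sum>v\<in>t. u v * ell2_nth v k)"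
      unfolding nth_sum[symmetric] t(3) by (simp add: zero_ell2.rep_eq)
    also have "\<dots> = (\<Sum>v\<in>{v}. u v * ell2_nth v k)"
    proof (rule sum.mono_neutral_right)
      show "\<forall>i\<in>t - {v}. u i * ell2_nth i k = 0"
      proof
        fix i assume i: "i \<in> t - {v}"
        then obtain j where "i = e j" using t(2) by blast
        then show "u i * ell2_nth i k = 0" using i k by (auto simp: e)
      qed
    qed (use t v in auto)
    finally show "u v = 0" by (simp add: k e)
  qed
  moreover assume "\<exists>S::ell2 set. finite S \<and> complex_vector.span S = UNIV"
  ultimately have "finite (range e)"
    using complex_vector.independent_span_bound by (metis subset_UNIV)
  then show False
    using inj by (simp add: finite_image_iff)
qed


section \<open>Operators and Schatten norms\<close>

definition bounded_operator :: "('h::chilbert_space \<Rightarrow> 'h) \<Rightarrow> bool" where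
  "bounded_operator T \<longleftrightarrow> bounded_linear T \<and> (\<forall>c x. T (c *\<^sub>C x) = c *\<^sub>C T x)"

definition rank_le :: "('h::chilbert_space \<Rightarrow> 'h) \<Rightarrow> nat \<Rightarrow> bool" where
  "rank_le T n \<longleftrightarrow> (\<exists>S. finite S \<and> card S \<le> n \<and> range T \<subseteq> complex_vector.span S)"

definition finite_rank :: "('h::chilbert_space \<Rightarrow> 'h) \<Rightarrow> bool" where
  "finite_rank T \<longleftrightarrow> (\<exists>n. rank_le T n)"

definition self_adjoint :: "('h::chilbert_space \<Rightarrow> 'h) \<Rightarrow> bool" where
  "self_adjoint T \<longleftrightarrow> (\<forall>x y. cinner (T x) y = cinner x (T y))"

text \<open>Singular values, numbered from \<open>0\<close>: \<open>s\<^sub>n(T)\<close> is the distance, in operator norm, from \<open>T\<close> to the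
  bounded operators of rank at most \<open>n\<close>.\<close>

definition singular_value :: "('h::chilbert_space \<Rightarrow> 'h) \<Rightarrow> nat \<Rightarrow> real" where
  "singular_value T n = Inf {onorm (\<lambda>x. T x - R x) |R. bounded_operator R \<and> rank_le R n}"

text \<open>The value is meaningful only for \<open>T\<close> in the Schatten class; below the norm is applied only to
  finite rank operators (also \<open>f(A\<^sub>1,B\<^sub>1,C\<^sub>1) - f(A\<^sub>2,B\<^sub>2,C\<^sub>2)\<close> has finite rank, because each
  \<open>f(A\<^sub>j,B\<^sub>j,C\<^sub>j)\<close> differs from \<open>f(0,0,0) I\<close> by a finite rank operator), for which the series has
  only finitely many nonzero terms.\<close>

definition schatten_norm :: "ereal \<Rightarrow> ('h::chilbert_space \<Rightarrow> 'h) \<Rightarrow> real" where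
  "schatten_norm p T =
     (if p = \<infinity> then onorm T
      else (\<Sum>n. singular_value T n powr real_of_ereal p) powr (1 / real_of_ereal p))"


section \<open>Functions of noncommuting triples\<close>

definition op_spectrum :: "('h::chilbert_space \<Rightarrow> 'h) \<Rightarrow> complex set" where
  "op_spectrum T = {z. \<not> (\<exists>R. bounded_operator R \<and>
     (\<forall>x. R (T x - z *\<^sub>C x) = x) \<and> (\<forall>x. T (R x) - z *\<^sub>C R x = x))}"

definition real_spectrum :: "('h::chilbert_space \<Rightarrow> 'h) \<Rightarrow> real set" where
  "real_spectrum T = {l. complex_of_real l \<in> op_spectrum T}"

definition orthogonal_projection :: "'h::chilbert_space set \<Rightarrow> 'h \<Rightarrow> 'h" where
  "orthogonal_projection M x = (THE y. y \<in> M \<and> (\<forall>z\<in>M. cinner (x - y) z = 0))"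

definition spectral_projection :: "('h::chilbert_space \<Rightarrow> 'h) \<Rightarrow> real \<Rightarrow> 'h \<Rightarrow> 'h" where
  "spectral_projection T l = orthogonal_projection {x. T x = complex_of_real l *\<^sub>C x}"

definition fun_of_triple ::
  "(real^3 \<Rightarrow> complex) \<Rightarrow> ('h::chilbert_space \<Rightarrow> 'h) \<Rightarrow> ('h \<Rightarrow> 'h) \<Rightarrow> ('h \<Rightarrow> 'h) \<Rightarrow> 'h \<Rightarrow> 'h" where
  "fun_of_triple f A B C x =
     (\<Sum>l\<in>real_spectrum A. \<Sum>m\<in>real_spectrum B. \<Sum>n\<in>real_spectrum C.
        f (vector [l, m, n]) *\<^sub>C
          spectral_projection A l (spectral_projection B m (spectral_projection C n x)))"


section \<open>Schwartz functions and tempered distributions\<close>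

definition partial_deriv ::
  "'a::euclidean_space \<Rightarrow> ('a \<Rightarrow> 'b::real_normed_vector) \<Rightarrow> 'a \<Rightarrow> 'b" where
  "partial_deriv b g x = frechet_derivative g (at x) b"

primrec iterated_deriv ::
  "'a::euclidean_space list \<Rightarrow> ('a \<Rightarrow> 'b::real_normed_vector) \<Rightarrow> 'a \<Rightarrow> 'b" where
  "iterated_deriv [] g = g"
| "iterated_deriv (b # bs) g = partial_deriv b (iterated_deriv bs g)"

definition smooth :: "('a::euclidean_space \<Rightarrow> 'b::real_normed_vector) \<Rightarrow> bool" where
  "smooth g \<longleftrightarrow> (\<forall>bs\<in>lists Basis. \<forall>x. iterated_deriv bs g differentiable (at x))"

definition schwartz :: "('a::euclidean_space \<Rightarrow> complex) \<Rightarrow> bool" where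
  "schwartz g \<longleftrightarrow> smooth g \<and>
     (\<forall>bs\<in>lists Basis. \<forall>k. bounded (range (\<lambda>x. (1 + norm x) ^ k *\<^sub>R iterated_deriv bs g x)))"

text \<open>Distributions are total functions on \<open>'a \<Rightarrow> complex\<close>, but only their values on Schwartz functions
  matter. Continuity is stated as a bound by finitely many of the defining seminorms.\<close>

definition tempered_distribution :: "(('a::euclidean_space \<Rightarrow> complex) \<Rightarrow> complex) \<Rightarrow> bool" where
  "tempered_distribution T \<longleftrightarrow>
     (\<forall>g h. schwartz g \<longrightarrow> schwartz h \<longrightarrow> T (\<lambda>x. g x + h x) = T g + T h) \<and>
     (\<forall>c g. schwartz g \<longrightarrow> T (\<lambda>x. c * g x) = c * T g) \<and>
     (\<exists>K N. \<forall>g M. schwartz g \<longrightarrow>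
        (\<forall>bs\<in>lists Basis. length bs \<le> N \<longrightarrow>
           (\<forall>x. (1 + norm x) ^ N * norm (iterated_deriv bs g x) \<le> M)) \<longrightarrow>
        norm (T g) \<le> K * M)"

text \<open>The pairing of a function with a test function is bilinear (no conjugation).\<close>

definition dist_of_fun :: "('a::euclidean_space \<Rightarrow> complex) \<Rightarrow> ('a \<Rightarrow> complex) \<Rightarrow> complex" where
  "dist_of_fun f g = (LINT x|lborel. f x * g x)"

definition dist_deriv ::
  "'a::euclidean_space \<Rightarrow> (('a \<Rightarrow> complex) \<Rightarrow> complex) \<Rightarrow> ('a \<Rightarrow> complex) \<Rightarrow> complex" where
  "dist_deriv b T g = - T (partial_deriv b g)"

definition dist_convolution ::
  "(('a::euclidean_space \<Rightarrow> complex) \<Rightarrow> complex) \<Rightarrow> ('a \<Rightarrow> complex) \<Rightarrow> 'a \<Rightarrow> complex" where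
  "dist_convolution T g x = T (\<lambda>y. g (x - y))"

definition fourier :: "('a::euclidean_space \<Rightarrow> complex) \<Rightarrow> 'a \<Rightarrow> complex" where
  "fourier g t = (LINT x|lborel. g x * exp (- \<i> * complex_of_real (x \<bullet> t)))"


section \<open>The Besov class\<close>

definition besov_cutoff :: "(real \<Rightarrow> real) \<Rightarrow> bool" where
  "besov_cutoff w \<longleftrightarrow> smooth w \<and> (\<forall>s. 0 \<le> w s) \<and> closure {s. w s \<noteq> 0} \<subseteq> {1/2..2} \<and>
     (\<forall>s\<in>{1..2}. w s = 1 - w (s / 2))"

text \<open>Since the Fourier transform is a bijection of the Schwartz space, this determines \<open>W\<close> uniquely
  from \<open>w\<close>.\<close>

definition besov_kernels :: "(real \<Rightarrow> real) \<Rightarrow> (int \<Rightarrow> 'a::euclidean_space \<Rightarrow> complex) \<Rightarrow> bool" where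
  "besov_kernels w W \<longleftrightarrow>
     (\<forall>n. schwartz (W n) \<and> (\<forall>x. fourier (W n) x = complex_of_real (w (norm x / 2 powi n))))"

definition Linfty_norm :: "('a::euclidean_space \<Rightarrow> complex) \<Rightarrow> ennreal" where
  "Linfty_norm g = esssup lborel (\<lambda>x. ennreal (norm (g x)))"

definition besov_norm ::
  "(int \<Rightarrow> 'a::euclidean_space \<Rightarrow> complex) \<Rightarrow> (('a \<Rightarrow> complex) \<Rightarrow> complex) \<Rightarrow> ennreal" where
  "besov_norm W T = (\<Sum>\<^sub>\<infinity>n. ennreal (2 powi n) * Linfty_norm (dist_convolution T (W n)))"

definition besov_distribution ::
  "(int \<Rightarrow> 'a::euclidean_space \<Rightarrow> complex) \<Rightarrow> (('a \<Rightarrow> complex) \<Rightarrow> complex) \<Rightarrow> bool" where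
  "besov_distribution W T \<longleftrightarrow> tempered_distribution T \<and> besov_norm W T < \<infinity> \<and>
     (\<forall>b\<in>Basis. \<forall>g. schwartz g \<longrightarrow>
        ((\<lambda>n. dist_deriv b (dist_of_fun (dist_convolution T (W n))) g) has_sum dist_deriv b T g) UNIV)"

text \<open>Continuous representatives of elements of the Besov class. Every such function is Lipschitz, so
  that requiring the pairing with all Schwartz functions to be integrable excludes none of them.\<close>

definition besov_function ::
  "(int \<Rightarrow> 'a::euclidean_space \<Rightarrow> complex) \<Rightarrow> ('a \<Rightarrow> complex) \<Rightarrow> bool" where
  "besov_function W f \<longleftrightarrow> continuous_on UNIV f \<and>
     (\<forall>g. schwartz g \<longrightarrow> integrable lborel (\<lambda>x. f x * g x)) \<and>
     besov_distribution W (dist_of_fun f)"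

end

theory Submission
  imports Defs "HOL-Probability.Sinc_Integral"
begin

text \<open>
  Let \<open>e\<^sub>1, \<dots>, e\<^sub>N\<close> and \<open>g\<^sub>1, \<dots>, g\<^sub>N\<close> be orthonormal bases of the same \<open>N\<close>-dimensional space, related by
  the discrete Fourier transform \<open>\<langle>g\<^sub>k, e\<^sub>j\<rangle> = N\<^sup>-\<^sup>1\<^sup>/\<^sup>2 cnj a\<^sub>j\<^sub>k\<close>, with \<open>\<bar>a\<^sub>j\<^sub>k\<bar> = 1\<close>, and let \<open>A\<close>, \<open>B\<close> be
  diagonal in these bases with eigenvalues \<open>1, \<dots>, N\<close>. If \<open>f(j, k, \<nu>) = a\<^sub>j\<^sub>k sin \<nu>\<close>, then
  \<open>f(A, B, C) = X sin C\<close> where \<open>X = \<Sum> a\<^sub>j\<^sub>k E\<^sub>j F\<^sub>k\<close> has all its matrix entries \<open>\<langle>X g\<^sub>k, e\<^sub>j\<rangle>\<close> equal to \<open>N\<^sup>-\<^sup>1\<^sup>/\<^sup>2\<close>, hence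
  is a rank one operator of norm \<open>\<surd>N\<close>. Replacing \<open>C = 0\<close> by \<open>\<pi>/2\<close> times the projection onto the unit
  vector on which \<open>X\<close> attains its norm changes \<open>f(A, B, C)\<close> by a rank one operator of norm \<open>\<surd>N\<close>; for rank
  one operators all Schatten norms agree.

  Interpolating the \<open>a\<^sub>j\<^sub>k\<close> with Fejer kernels of period \<open>N + 1\<close>, which are nonnegative and sum up to \<open>1\<close>
  over the integer points of a period, gives a trigonometric polynomial \<open>f\<close> with \<open>\<bar>f\<bar> \<le> 1\<close> and with
  frequencies in an annulus that does not depend on \<open>N\<close>; as \<open>0\<close> is not a multiple of the period away from
  \<open>1, \<dots>, N\<close>, the infinite-dimensional kernels of \<open>A\<close> and \<open>B\<close> contribute nothing. So only finitely many \<open>f * W\<^sub>n\<close> are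
  nonzero, each is bounded by the \<open>L\<^sup>1\<close> norm of \<open>W\<^sub>n\<close>, and the Besov norm of \<open>f\<close> is bounded uniformly in \<open>N\<close>.
\<close>

section \<open>Inner products and orthonormal families\<close>

lemma cinner_add_right: "cinner x (y + z) = cinner x y + cinner x z"
  for x :: "'h::chilbert_space"
  by (metis cinner_commute cinner_add_left complex_cnj_add)

lemma cinner_scaleC_right: "cinner x (c *\<^sub>C y) = cnj c * cinner x y"
  for x :: "'h::chilbert_space"
  by (metis cinner_commute cinner_scaleC_left complex_cnj_mult)

lemma cinner_zero_left [simp]: "cinner 0 y = 0"
  and cinner_zero_right [simp]: "cinner y 0 = 0"
  for y :: "'h::chilbert_space"
  using cinner_add_left[of 0 0 y] cinner_add_right[of y 0 0] by simp_all

lemma cinner_diff_left: "cinner (x - y) z = cinner x z - cinner y z"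
  for x :: "'h::chilbert_space"
  using cinner_add_left[of "x - y" y z] by (simp add: algebra_simps)

lemma cinner_sum_left: "cinner (\<Sum>i\<in>I. f i) z = (\<Sum>i\<in>I. cinner (f i) z)"
  for z :: "'h::chilbert_space"
  by (induction I rule: infinite_finite_induct) (auto simp: cinner_add_left)

lemma cinner_sum_right: "cinner z (\<Sum>i\<in>I. f i) = (\<Sum>i\<in>I. cinner z (f i))"
  for z :: "'h::chilbert_space"
  by (induction I rule: infinite_finite_induct) (auto simp: cinner_add_right)

lemma cinner_self_eq_0_iff: "cinner x x = 0 \<longleftrightarrow> x = 0"
  for x :: "'h::chilbert_space"
  by (simp add: cinner_self)

lemma norm_eq_1_of_cinner:
  fixes x :: "'h::chilbert_space"
  assumes "cinner x x = 1"
  shows "norm x = 1"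
proof (rule power2_eq_imp_eq)
  have "complex_of_real ((norm x)\<^sup>2) = 1"
    using assms by (simp only: cinner_self)
  then show "(norm x)\<^sup>2 = 1\<^sup>2"
    by (simp only: of_real_eq_1_iff one_power2)
qed simp_all

lemma norm_scaleC: "norm (c *\<^sub>C x) = cmod c * norm x"
  for x :: "'h::chilbert_space"
proof -
  have "complex_of_real ((norm (c *\<^sub>C x))\<^sup>2) = c * cnj c * complex_of_real ((norm x)\<^sup>2)"
    by (simp only: cinner_self[symmetric] cinner_scaleC_left cinner_scaleC_right mult.assoc mult.left_commute)
  also have "\<dots> = complex_of_real ((cmod c * norm x)\<^sup>2)"
    by (simp add: complex_norm_square[symmetric] power_mult_distrib)
  finally have "(norm (c *\<^sub>C x))\<^sup>2 = (cmod c * norm x)\<^sup>2"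
    using of_real_eq_iff by blast
  then show ?thesis
    by (rule power2_eq_imp_eq) auto
qed

text \<open>Pythagoras: removing the component of \<open>x\<close> along \<open>v\<close> leaves a
  vector orthogonal to \<open>v\<close>. This case of Cauchy-Schwarz suffices for the rank one
  operators below.\<close>

lemma cinner_unit_bound:
  fixes x v :: "'h::chilbert_space"
  assumes "cinner v v = 1"
  shows "cmod (cinner x v) \<le> norm x"
proof -
  define y where "y = x - cinner x v *\<^sub>C v"
  have y: "cinner y v = 0"
    by (simp add: y_def cinner_diff_left cinner_scaleC_left assms)
  have "complex_of_real ((norm x)\<^sup>2) = cinner (y + cinner x v *\<^sub>C v) (y + cinner x v *\<^sub>C v)"
    by (simp add: y_def cinner_self)
  also have "\<dots> = cinner y y + cinner x v * cnj (cinner x v)"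
    using y cinner_commute[of v y]
    by (simp add: cinner_add_left cinner_add_right cinner_scaleC_left cinner_scaleC_right assms)
  also have "\<dots> = complex_of_real ((norm y)\<^sup>2 + (cmod (cinner x v))\<^sup>2)"
    by (simp add: cinner_self complex_norm_square[symmetric])
  finally have "(norm x)\<^sup>2 = (norm y)\<^sup>2 + (cmod (cinner x v))\<^sup>2"
    using of_real_eq_iff by blast
  then have "(cmod (cinner x v))\<^sup>2 \<le> (norm x)\<^sup>2" by simp
  then show ?thesis
    by (rule power2_le_imp_le) simp
qed

definition orthonormal_on :: "'i set \<Rightarrow> ('i \<Rightarrow> 'h::chilbert_space) \<Rightarrow> bool" where
  "orthonormal_on J e \<longleftrightarrow> (\<forall>i\<in>J. \<forall>j\<in>J. cinner (e i) (e j) = (if i = j then 1 else 0))"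

lemma orthonormal_onD:
  "orthonormal_on J e \<Longrightarrow> i \<in> J \<Longrightarrow> j \<in> J \<Longrightarrow> cinner (e i) (e j) = (if i = j then 1 else 0)"
  by (simp add: orthonormal_on_def)

lemma cinner_orthonormal_sum:
  assumes "orthonormal_on J e" "finite J" "j \<in> J"
  shows "cinner (\<Sum>i\<in>J. c i *\<^sub>C e i) (e j) = c j"
proof -
  have "cinner (\<Sum>i\<in>J. c i *\<^sub>C e i) (e j) = (\<Sum>i\<in>J. if i = j then c i else 0)"
    unfolding cinner_sum_left using assms
    by (intro sum.cong refl) (simp add: cinner_scaleC_left orthonormal_onD)
  then show ?thesis
    using assms by simp
qed

lemma cinner_orthonormal_sums:
  assumes "orthonormal_on J e" "finite J"
  shows "cinner (\<Sum>i\<in>J. c i *\<^sub>C e i) (\<Sum>i\<in>J. d i *\<^sub>C e i) = (\<Sum>i\<in>J. c i * cnj (d i))"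
  by (simp add: cinner_sum_right cinner_scaleC_right cinner_orthonormal_sum assms mult.commute)

text \<open>One Gram-Schmidt step per induction step; a vector outside the span is always available
  because no finite set spans the space.\<close>

lemma orthonormal_exists:
  assumes "infinite_dimensional TYPE('h::chilbert_space)"
  shows "\<exists>e :: nat \<Rightarrow> 'h. orthonormal_on {..<n} e"
proof (induction n)
  case 0
  then show ?case by (simp add: orthonormal_on_def)
next
  case (Suc n)
  then obtain e :: "nat \<Rightarrow> 'h" where e: "orthonormal_on {..<n} e" by blast
  obtain x where x: "x \<notin> complex_vector.span (e ` {..<n})"
    using assms unfolding infinite_dimensional_def by blast
  define y where "y = x - (\<Sum>i<n. cinner x (e i) *\<^sub>C e i)"
  have "(\<Sum>i<n. cinner x (e i) *\<^sub>C e i) \<in> complex_vector.span (e ` {..<n})"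
    by (intro complex_vector.span_sum complex_vector.span_scale complex_vector.span_base) auto
  then have "y \<noteq> 0"
    using x unfolding y_def by auto
  define z where "z = complex_of_real (1 / norm y) *\<^sub>C y"
  have yz: "cinner y (e j) = 0" if "j < n" for j
    using that by (simp add: y_def cinner_diff_left cinner_orthonormal_sum[OF e])
  have z: "cinner z (e j) = 0" if "j < n" for j
    using yz[OF that] by (simp add: z_def cinner_scaleC_left)
  then have z': "cinner (e j) z = 0" if "j < n" for j
    using that by (metis cinner_commute complex_cnj_zero)
  have zz: "cinner z z = 1"
    using \<open>y \<noteq> 0\<close> by (simp add: cinner_self z_def norm_scaleC norm_divide)
  have "orthonormal_on {..<Suc n} (e(n := z))"
    unfolding orthonormal_on_def
  proof (intro ballI)
    fix i j assume "i \<in> {..<Suc n}" "j \<in> {..<Suc n}"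
    then have "i = n \<or> i < n" "j = n \<or> j < n" by auto
    then show "cinner ((e(n := z)) i) ((e(n := z)) j) = (if i = j then 1 else 0)"
      using z z' zz orthonormal_onD[OF e, of i j] by fastforce
  qed
  then show ?case by blast
qed

section \<open>Diagonal operators and their functions\<close>

text \<open>The family need not span the space: on the orthogonal complement of its vectors the
  operator is zero. An empty \<open>J\<close> gives the zero operator, which thus falls under the
  same formulas.\<close>

definition diag_op :: "'i set \<Rightarrow> ('i \<Rightarrow> real) \<Rightarrow> ('i \<Rightarrow> 'h) \<Rightarrow> 'h \<Rightarrow> 'h::chilbert_space" where
  "diag_op J a e x = (\<Sum>j\<in>J. (complex_of_real (a j) * cinner x (e j)) *\<^sub>C e j)"

lemma bounded_linear_scaleC_right: "bounded_linear (\<lambda>x::'h::chilbert_space. c *\<^sub>C x)"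
proof (rule bounded_linear_intro[where K = "cmod c"])
  fix x y :: 'h and r :: real
  show "c *\<^sub>C (r *\<^sub>R x) = r *\<^sub>R (c *\<^sub>C x)"
    by (simp add: scaleR_scaleC scaleC_scaleC mult.commute)
qed (simp_all add: scaleC_add_right norm_scaleC mult.commute)

lemma bounded_linear_rank_one:
  fixes u v :: "'h::chilbert_space"
  assumes "cinner v v = 1"
  shows "bounded_linear (\<lambda>x. (c * cinner x v) *\<^sub>C u)"
proof (rule bounded_linear_intro[where K = "cmod c * norm u"])
  fix x y :: 'h and r :: real
  show "(c * cinner (r *\<^sub>R x) v) *\<^sub>C u = r *\<^sub>R ((c * cinner x v) *\<^sub>C u)"
    by (simp add: scaleR_scaleC cinner_scaleC_left scaleC_scaleC mult.left_commute)
  have "cmod c * cmod (cinner x v) * norm u \<le> cmod c * norm x * norm u"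
    by (intro mult_right_mono mult_left_mono cinner_unit_bound assms) auto
  then show "norm ((c * cinner x v) *\<^sub>C u) \<le> norm x * (cmod c * norm u)"
    by (simp add: norm_scaleC norm_mult mult_ac)
qed (simp only: cinner_add_left scaleC_add_left distrib_left)

lemma bounded_operator_rank_one:
  fixes u v :: "'h::chilbert_space"
  assumes "cinner v v = 1"
  shows "bounded_operator (\<lambda>x. (c * cinner x v) *\<^sub>C u)"
  unfolding bounded_operator_def
proof (intro conjI allI)
  show "bounded_linear (\<lambda>x. (c * cinner x v) *\<^sub>C u)"
    by (rule bounded_linear_rank_one[OF assms])
  show "(c * cinner (d *\<^sub>C x) v) *\<^sub>C u = d *\<^sub>C (c * cinner x v) *\<^sub>C u" for d x
    by (simp add: cinner_scaleC_left scaleC_scaleC mult.left_commute)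
qed

lemma bounded_operator_sum:
  assumes "\<And>i. i \<in> I \<Longrightarrow> bounded_operator (T i)"
  shows "bounded_operator (\<lambda>x. \<Sum>i\<in>I. T i x)"
  using assms unfolding bounded_operator_def
  by (auto intro!: bounded_linear_sum sum.cong simp: complex_vector.scale_sum_right)

lemma bounded_operator_diag_op:
  assumes "orthonormal_on J e"
  shows "bounded_operator (diag_op J a e)"
  unfolding diag_op_def[abs_def] using assms
  by (intro bounded_operator_sum bounded_operator_rank_one) (simp add: orthonormal_onD)

lemma finite_rank_diag_op:
  assumes "finite J"
  shows "finite_rank (diag_op J a e)"
  unfolding finite_rank_def rank_le_def
proof (intro exI conjI)
  show "finite (e ` J)" "card (e ` J) \<le> card J"
    using assms by (auto intro: card_image_le)
  show "range (diag_op J a e) \<subseteq> complex_vector.span (e ` J)"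
    unfolding diag_op_def
    by (auto intro!: complex_vector.span_sum complex_vector.span_scale intro: complex_vector.span_base)
qed

lemma self_adjoint_diag_op: "self_adjoint (diag_op J a e)"
  unfolding self_adjoint_def diag_op_def
proof (intro allI)
  fix x y
  have "cinner (e j) y = cnj (cinner y (e j))" for j
    by (rule cinner_commute)
  then show "cinner (\<Sum>j\<in>J. (complex_of_real (a j) * cinner x (e j)) *\<^sub>C e j) y =
      cinner x (\<Sum>j\<in>J. (complex_of_real (a j) * cinner y (e j)) *\<^sub>C e j)"
    by (simp add: cinner_sum_left cinner_sum_right cinner_scaleC_left cinner_scaleC_right mult_ac)
qed

section \<open>Spectra and spectral projections of diagonal operators\<close>

lemma diag_op_eigen:
  assumes "orthonormal_on J e" "finite J" "j \<in> J"
  shows "diag_op J a e (e j) = complex_of_real (a j) *\<^sub>C e j"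
proof -
  have "diag_op J a e (e j) = (\<Sum>i\<in>J. if i = j then complex_of_real (a i) *\<^sub>C e i else 0)"
    unfolding diag_op_def using assms by (intro sum.cong refl) (simp add: orthonormal_onD)
  then show ?thesis using assms by simp
qed

lemma cinner_diag_op:
  assumes "orthonormal_on J e" "finite J" "j \<in> J"
  shows "cinner (diag_op J a e x) (e j) = complex_of_real (a j) * cinner x (e j)"
  unfolding diag_op_def by (rule cinner_orthonormal_sum[OF assms])

text \<open>At any other \<open>l\<close> the resolvent is explicit: \<open>1 / (a j - l)\<close> on
  \<open>e j\<close> and \<open>- 1 / l\<close> on the orthogonal complement. The value
  \<open>0\<close> accounts for that complement, which may be trivial; hence only an
  inclusion.\<close>

lemma real_spectrum_diag_op_subset:
  assumes e: "orthonormal_on J e" and J: "finite J"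
  shows "real_spectrum (diag_op J a e) \<subseteq> insert 0 (a ` J)"
proof
  fix l assume l: "l \<in> real_spectrum (diag_op J a e)"
  show "l \<in> insert 0 (a ` J)"
  proof (rule ccontr)
    assume neg: "l \<notin> insert 0 (a ` J)"
    let ?T = "diag_op J a e"
    let ?z = "complex_of_real l"
    define P where "P x = (\<Sum>j\<in>J. cinner x (e j) *\<^sub>C e j)" for x
    define Q where "Q x = (\<Sum>j\<in>J. (1 / complex_of_real (a j - l) * cinner x (e j)) *\<^sub>C e j)" for x
    \<comment> \<open>\<open>P\<close> projects onto the span of the family, so
      \<open>x - P x\<close> lies in the complement, where the operator is zero.\<close>
    define R where "R x = Q x - (1 / ?z) *\<^sub>C (x - P x)" for x
    have z: "?z \<noteq> 0" "\<And>j. j \<in> J \<Longrightarrow> complex_of_real (a j) - ?z \<noteq> 0"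
      using neg by auto
    have "bounded_operator (diag_op J (\<lambda>_. 1) e)" 
      by (rule bounded_operator_diag_op[OF e])
    then have bP: "bounded_operator P"
      by (simp add: P_def[abs_def] diag_op_def[abs_def])
    have bQ: "bounded_operator Q"
      unfolding Q_def[abs_def] using e
      by (intro bounded_operator_sum bounded_operator_rank_one) (simp add: orthonormal_onD)
    have "bounded_linear R"
      unfolding R_def[abs_def] using bP bQ unfolding bounded_operator_def
      by (intro bounded_linear_sub bounded_linear_compose[OF bounded_linear_scaleC_right]
        bounded_linear_ident) auto
    moreover have "R (c *\<^sub>C x) = c *\<^sub>C R x" for c x
      using bP bQ unfolding bounded_operator_def R_def
      by (simp add: complex_vector.scale_right_diff_distrib scaleC_scaleC mult.commute)
    ultimately have "bounded_operator R"
      by (simp add: bounded_operator_def)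
    moreover have "R (?T x - ?z *\<^sub>C x) = x" for x
    proof -
      have "R (?T x - ?z *\<^sub>C x) =
          (\<Sum>j\<in>J. cinner x (e j) *\<^sub>C e j) - (1 / ?z) *\<^sub>C (?T x - ?z *\<^sub>C x - (?T x - ?z *\<^sub>C P x))"
        unfolding R_def Q_def
      proof (intro arg_cong2[of _ _ _ _ "(-)"] sum.cong refl arg_cong2[of _ _ _ _ "(*\<^sub>C)"])
        fix j assume "j \<in> J"
        then show "1 / complex_of_real (a j - l) * cinner (?T x - ?z *\<^sub>C x) (e j) = cinner x (e j)"
          using z(2)[of j]
          by (simp add: cinner_diff_left cinner_scaleC_left cinner_diag_op[OF e J] left_diff_distrib[symmetric])
      next
        show "P (?T x - ?z *\<^sub>C x) = ?T x - ?z *\<^sub>C P x"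
          unfolding P_def diag_op_def[of J a e x, symmetric]
          by (simp add: cinner_diff_left cinner_scaleC_left cinner_diag_op[OF e J]
            complex_vector.scale_left_diff_distrib sum_subtractf complex_vector.scale_sum_right scaleC_scaleC)
            (simp add: diag_op_def)
      qed
      also have "\<dots> = x"
        using z(1) by (simp add: complex_vector.scale_right_diff_distrib scaleC_scaleC P_def)
      finally show ?thesis .
    qed
    moreover have "?T (R x) - ?z *\<^sub>C R x = x" for x
    proof -
      have PJ: "cinner (P x) (e j) = cinner x (e j)" if "j \<in> J" for j
        unfolding P_def using that by (simp add: cinner_orthonormal_sum[OF e J])
      have RJ: "cinner (R x) (e j) = 1 / complex_of_real (a j - l) * cinner x (e j)" if "j \<in> J" for j
        unfolding R_def using that
        by (simp add: cinner_diff_left cinner_scaleC_left PJ) (simp add: Q_def cinner_orthonormal_sum[OF e J])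
      have "?T (R x) - ?z *\<^sub>C Q x = P x"
        unfolding diag_op_def Q_def P_def complex_vector.scale_sum_right sum_subtractf[symmetric]
      proof (intro sum.cong refl)
        fix j assume j: "j \<in> J"
        have "complex_of_real (a j) * (1 / complex_of_real (a j - l) * cinner x (e j))
            - ?z * (1 / complex_of_real (a j - l) * cinner x (e j)) =
            (complex_of_real (a j) - ?z) * (1 / complex_of_real (a j - l)) * cinner x (e j)"
          by (simp only: left_diff_distrib mult.assoc)
        also have "\<dots> = cinner x (e j)"
          using z(2)[OF j] by simp
        finally have "complex_of_real (a j) * (1 / complex_of_real (a j - l) * cinner x (e j))
            - ?z * (1 / complex_of_real (a j - l) * cinner x (e j)) = cinner x (e j)" .
        then show "(complex_of_real (a j) * cinner (R x) (e j)) *\<^sub>C e j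
           - ?z *\<^sub>C (1 / complex_of_real (a j - l) * cinner x (e j)) *\<^sub>C e j = cinner x (e j) *\<^sub>C e j"
          by (simp only: RJ[OF j] scaleC_scaleC complex_vector.scale_left_diff_distrib[symmetric])
      qed
      moreover have "?z *\<^sub>C R x = ?z *\<^sub>C Q x - (x - P x)"
        using z(1) by (simp add: R_def complex_vector.scale_right_diff_distrib scaleC_scaleC)
      ultimately show ?thesis by (simp add: algebra_simps)
    qed
    ultimately show False
      using l unfolding real_spectrum_def op_spectrum_def by blast
  qed
qed

lemma eigenvalue_in_real_spectrum:
  assumes "T x = complex_of_real l *\<^sub>C x" "x \<noteq> 0"
  shows "l \<in> real_spectrum T"
proof -
  have False if R: "bounded_operator R" "\<forall>x. R (T x - complex_of_real l *\<^sub>C x) = x" for R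
  proof -
    have "R 0 = 0"
      using R(1) by (metis bounded_operator_def complex_vector.scale_zero_left)
    then show False
      using R(2)[rule_format, of x] assms by simp
  qed
  then show ?thesis
    unfolding real_spectrum_def op_spectrum_def by blast
qed

text \<open>The difference of two candidates lies in \<open>M\<close> and is therefore orthogonal to
  itself. This is how the definite description gets evaluated for concrete eigenspaces.\<close>

lemma orthogonal_projection_unique:
  assumes y: "y \<in> M" "\<And>z. z \<in> M \<Longrightarrow> cinner (x - y) z = 0"
    and M: "\<And>y z. y \<in> M \<Longrightarrow> z \<in> M \<Longrightarrow> y - z \<in> M"
  shows "orthogonal_projection M x = y"
  unfolding orthogonal_projection_def
proof (rule the_equality)
  show "y \<in> M \<and> (\<forall>z\<in>M. cinner (x - y) z = 0)" using y by blast
next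
  fix y' assume y': "y' \<in> M \<and> (\<forall>z\<in>M. cinner (x - y') z = 0)"
  have "cinner (y - y') (y - y') = cinner (x - y') (y - y') - cinner (x - y) (y - y')"
    by (simp add: cinner_diff_left)
  also have "\<dots> = 0"
    using y y' M by simp
  finally show "y' = y" by (simp add: cinner_self_eq_0_iff)
qed

text \<open>Since \<open>a j\<close> is nonzero, its eigenspace contains nothing of the orthogonal
  complement of the family, and injectivity of \<open>a\<close> keeps out the other basis vectors.
  What remains is the line through \<open>e j\<close>.\<close>

lemma spectral_projection_diag_op:
  assumes e: "orthonormal_on J e" and J: "finite J" and j: "j \<in> J" and a: "inj_on a J" "a j \<noteq> 0"
  shows "spectral_projection (diag_op J a e) (a j) x = cinner x (e j) *\<^sub>C e j"
  unfolding spectral_projection_def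
proof (rule orthogonal_projection_unique)
  have bl: "bounded_operator (diag_op J a e)"
    by (rule bounded_operator_diag_op[OF e])
  then show "cinner x (e j) *\<^sub>C e j \<in> {x. diag_op J a e x = complex_of_real (a j) *\<^sub>C x}"
    by (simp add: bounded_operator_def diag_op_eigen[OF e J j] scaleC_scaleC mult.commute)
  show "y - z \<in> {x. diag_op J a e x = complex_of_real (a j) *\<^sub>C x}"
    if "y \<in> {x. diag_op J a e x = complex_of_real (a j) *\<^sub>C x}"
      "z \<in> {x. diag_op J a e x = complex_of_real (a j) *\<^sub>C x}" for y z
    using that bl by (auto simp: bounded_operator_def linear_diff bounded_linear.linear
      complex_vector.scale_right_diff_distrib)
  fix z assume "z \<in> {x. diag_op J a e x = complex_of_real (a j) *\<^sub>C x}"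
  then have z: "diag_op J a e z = complex_of_real (a j) *\<^sub>C z" by simp
  have zi: "cinner z (e i) = 0" if i: "i \<in> J" "i \<noteq> j" for i
  proof -
    have "complex_of_real (a i) * cinner z (e i) = complex_of_real (a j) * cinner z (e i)"
      using cinner_diag_op[OF e J i(1), of a z] unfolding z by (simp only: cinner_scaleC_left)
    moreover have "a i \<noteq> a j"
      using inj_onD[OF a(1) _ i(1) j] i(2) by blast
    ultimately show ?thesis by simp
  qed
  have "complex_of_real (a j) *\<^sub>C z = (\<Sum>i\<in>J. if i = j then complex_of_real (a j) *\<^sub>C cinner z (e j) *\<^sub>C e j else 0)"
    unfolding z[symmetric] diag_op_def using zi by (intro sum.cong refl) (auto simp: scaleC_scaleC)
  then have "complex_of_real (a j) *\<^sub>C z = complex_of_real (a j) *\<^sub>C cinner z (e j) *\<^sub>C e j"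
    using J j by simp
  then have "z = cinner z (e j) *\<^sub>C e j"
    using a(2) complex_vector.scale_left_imp_eq[of "complex_of_real (a j)"] by (metis of_real_eq_0_iff)
  moreover have "cinner (x - cinner x (e j) *\<^sub>C e j) (c *\<^sub>C e j) = 0" for c
    using e j by (simp add: cinner_scaleC_right cinner_diff_left cinner_scaleC_left orthonormal_onD)
  ultimately show "cinner (x - cinner x (e j) *\<^sub>C e j) z = 0" by metis
qed

text \<open>Whether \<open>0\<close> belongs to the spectrum depends on the dimension of the space;
  \<open>g 0 = 0\<close> settles both cases at once.\<close>

lemma sum_real_spectrum_diag_op:
  fixes e :: "'i \<Rightarrow> 'h::chilbert_space" and g :: "real \<Rightarrow> 'b::comm_monoid_add"
  assumes e: "orthonormal_on J e" and J: "finite J" and a: "inj_on a J" and g: "g 0 = 0"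
  shows "(\<Sum>l\<in>real_spectrum (diag_op J a e). g l) = (\<Sum>j\<in>J. g (a j))"
proof -
  have "(\<Sum>l\<in>real_spectrum (diag_op J a e). g l) = (\<Sum>l\<in>a ` J. g l)"
  proof (rule sum.mono_neutral_right)
    show "finite (real_spectrum (diag_op J a e))"
      using real_spectrum_diag_op_subset[OF e J] J by (auto intro: finite_subset)
    show "\<forall>i\<in>real_spectrum (diag_op J a e) - a ` J. g i = 0"
      using real_spectrum_diag_op_subset[OF e J] g by auto
    show "a ` J \<subseteq> real_spectrum (diag_op J a e)"
    proof
      fix l assume "l \<in> a ` J"
      then obtain j where j: "j \<in> J" "l = a j" by auto
      have "e j \<noteq> 0"
        using orthonormal_onD[OF e j(1) j(1)] by auto
      then show "l \<in> real_spectrum (diag_op J a e)"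
        using eigenvalue_in_real_spectrum[where T = "diag_op J a e", OF diag_op_eigen[OF e J j(1), of a]] j by blast
    qed
  qed
  then show ?thesis using a by (simp add: sum.reindex)
qed

text \<open>With nonzero eigenvalues and \<open>f\<close> vanishing on the coordinate planes, only
  projections onto lines remain, and their products reduce to inner products of basis
  vectors.\<close>

lemma fun_of_triple_diag_op:
  fixes u :: "'i \<Rightarrow> 'h::chilbert_space" and v :: "'j \<Rightarrow> 'h" and w :: "'k \<Rightarrow> 'h"
  assumes u: "orthonormal_on I u" and I: "finite I" and a: "inj_on a I" "0 \<notin> a ` I"
    and v: "orthonormal_on J v" and J: "finite J" and b: "inj_on b J" "0 \<notin> b ` J"
    and w: "orthonormal_on K w" and K: "finite K" and c: "inj_on c K" "0 \<notin> c ` K"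
    and f: "\<And>l m n. l = 0 \<or> m = 0 \<or> n = 0 \<Longrightarrow> f (vector [l, m, n]) = 0"
  shows "fun_of_triple f (diag_op I a u) (diag_op J b v) (diag_op K c w) x =
    (\<Sum>i\<in>I. \<Sum>j\<in>J. \<Sum>k\<in>K. (f (vector [a i, b j, c k]) * cinner x (w k) * cinner (w k) (v j)
       * cinner (v j) (u i)) *\<^sub>C u i)"
proof -
  have "fun_of_triple f (diag_op I a u) (diag_op J b v) (diag_op K c w) x =
    (\<Sum>i\<in>I. \<Sum>j\<in>J. \<Sum>k\<in>K. f (vector [a i, b j, c k]) *\<^sub>C
       spectral_projection (diag_op I a u) (a i) (spectral_projection (diag_op J b v) (b j)
         (spectral_projection (diag_op K c w) (c k) x)))"
    unfolding fun_of_triple_def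
    \<comment> \<open>Each round replaces one of the three spectra by its index set; the side
      condition at \<open>0\<close> is the vanishing of \<open>f\<close>.\<close>
    by (subst sum_real_spectrum_diag_op, (fact | simp add: f)+)+
  also have "\<dots> = (\<Sum>i\<in>I. \<Sum>j\<in>J. \<Sum>k\<in>K. (f (vector [a i, b j, c k]) * cinner x (w k) * cinner (w k) (v j)
       * cinner (v j) (u i)) *\<^sub>C u i)"
  proof (intro sum.cong refl)
    fix i j k assume i: "i \<in> I" and j: "j \<in> J" and k: "k \<in> K"
    have nz: "a i \<noteq> 0" "b j \<noteq> 0" "c k \<noteq> 0"
      using a(2) b(2) c(2) i j k by force+
    show "f (vector [a i, b j, c k]) *\<^sub>C
       spectral_projection (diag_op I a u) (a i) (spectral_projection (diag_op J b v) (b j)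
         (spectral_projection (diag_op K c w) (c k) x)) =
      (f (vector [a i, b j, c k]) * cinner x (w k) * cinner (w k) (v j) * cinner (v j) (u i)) *\<^sub>C u i"
      by (simp add: spectral_projection_diag_op[OF u I i a(1) nz(1)]
         spectral_projection_diag_op[OF v J j b(1) nz(2)] spectral_projection_diag_op[OF w K k c(1) nz(3)]
         cinner_scaleC_left scaleC_scaleC mult_ac)
  qed
  finally show ?thesis .
qed

section \<open>Schatten norms of rank one operators\<close>

text \<open>The upper bound is Cauchy-Schwarz, and the unit vector \<open>v\<close> attains
  it.\<close>

lemma onorm_rank_one:
  fixes u v :: "'h::chilbert_space"
  assumes v: "cinner v v = 1" and u: "norm u = 1"
  shows "onorm (\<lambda>x. (c * cinner x v) *\<^sub>C u) = cmod c"
proof (rule antisym)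
  show "onorm (\<lambda>x. (c * cinner x v) *\<^sub>C u) \<le> cmod c"
    by (rule onorm_bound) (auto simp: norm_scaleC norm_mult u intro!: mult_left_mono cinner_unit_bound v)
  have "norm v = 1"
    using v by (rule norm_eq_1_of_cinner)
  then show "cmod c \<le> onorm (\<lambda>x. (c * cinner x v) *\<^sub>C u)"
    using onorm[OF bounded_linear_rank_one[OF v, of c u], where x = v] by (simp add: v norm_scaleC u)
qed

lemma rank_le_0_iff: "rank_le R 0 \<longleftrightarrow> (\<forall>x. R x = 0)"
proof
  assume "rank_le R 0"
  then obtain S where S: "finite S" "card S = 0" "range R \<subseteq> complex_vector.span S"
    unfolding rank_le_def by auto
  then have "S = {}" by simp
  then show "\<forall>x. R x = 0" using S(3) by auto
next
  assume "\<forall>x. R x = 0"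
  then show "rank_le R 0"
    unfolding rank_le_def by (intro exI[of _ "{}"]) auto
qed

lemma singular_value_0:
  fixes T :: "'h::chilbert_space \<Rightarrow> 'h"
  shows "singular_value T 0 = onorm T"
proof -
  have bo: "bounded_operator (\<lambda>x::'h. 0::'h)"
    by (simp add: bounded_operator_def)
  have "{onorm (\<lambda>x. T x - R x) |R. bounded_operator R \<and> rank_le R 0} = {onorm T}"
  proof safe
    fix R :: "'h \<Rightarrow> 'h" assume "rank_le R 0"
    then show "onorm (\<lambda>x. T x - R x) = onorm T"
      by (simp add: rank_le_0_iff)
  next
    show "\<exists>R. onorm T = onorm (\<lambda>x. T x - R x) \<and> bounded_operator R \<and> rank_le R 0"
      by (intro exI[of _ "\<lambda>x. 0"]) (simp add: bo rank_le_0_iff)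
  qed
  then show ?thesis by (simp add: singular_value_def)
qed

lemma singular_value_eq_0:
  fixes T :: "'h::chilbert_space \<Rightarrow> 'h"
  assumes "bounded_operator T" "rank_le T n"
  shows "singular_value T n = 0"
proof -
  let ?S = "{onorm (\<lambda>x. T x - R x) |R. bounded_operator R \<and> rank_le R n}"
  have "0 \<in> ?S"
    using assms by (auto intro!: exI[of _ T] simp: onorm_zero)
  moreover have nn: "0 \<le> y" if "y \<in> ?S" for y
    using that assms(1) unfolding bounded_operator_def by (auto intro!: onorm_pos_le bounded_linear_sub)
  ultimately have "Inf ?S = 0"
    by (intro cInf_eq_minimum) auto
  then show ?thesis by (simp add: singular_value_def)
qed

text \<open>Only the singular value with index \<open>0\<close>, the operator norm, can be nonzero,
  so every \<open>p\<close> yields the same number.\<close>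

lemma schatten_norm_rank_one:
  fixes u v :: "'h::chilbert_space"
  assumes v: "cinner v v = 1" and u: "norm u = 1" and p: "1 \<le> p"
  shows "schatten_norm p (\<lambda>x. (c * cinner x v) *\<^sub>C u) = cmod c"
proof (cases "p = \<infinity>")
  case True
  then show ?thesis by (simp add: schatten_norm_def onorm_rank_one v u)
next
  case False
  then obtain q where q: "p = ereal q" "1 \<le> q"
    using p by (cases p) (auto simp: one_ereal_def)
  let ?T = "\<lambda>x. (c * cinner x v) *\<^sub>C u"
  have "singular_value ?T n = 0" if "n \<noteq> 0" for n
  proof (rule singular_value_eq_0)
    show "bounded_operator ?T" by (rule bounded_operator_rank_one[OF v])
    show "rank_le ?T n"
      unfolding rank_le_def using that
      by (intro exI[of _ "{u}"]) (auto intro!: complex_vector.span_scale intro: complex_vector.span_base)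
  qed
  then have "(\<Sum>n. singular_value ?T n powr q) = (\<Sum>n\<in>{0}. singular_value ?T n powr q)"
    by (intro suminf_finite) auto
  also have "\<dots> = cmod c powr q"
    by (simp add: singular_value_0 onorm_rank_one v u)
  finally show ?thesis
    using q by (simp add: schatten_norm_def powr_powr)
qed

lemma schatten_norm_zero: "schatten_norm p (\<lambda>x::'h::chilbert_space. 0::'h) = 0"
proof -
  have "singular_value (\<lambda>x::'h. 0::'h) n = 0" for n
  proof (rule singular_value_eq_0)
    show "bounded_operator (\<lambda>x::'h. 0::'h)" by (simp add: bounded_operator_def)
    show "rank_le (\<lambda>x::'h. 0::'h) n"
      unfolding rank_le_def by (intro exI[of _ "{}"]) auto
  qed
  then show ?thesis by (simp add: schatten_norm_def onorm_zero)
qed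

section \<open>Bounded functions as tempered distributions\<close>

text \<open>Each coordinate satisfies
  \<open>1 + (x \<bullet> b)\<^sup>2 \<le> (1 + norm x)\<^sup>2\<close>. The exponent provides one
  such factor per basis vector, and the product of the reciprocals is integrable because each factor
  is integrable on the line.\<close>

lemma integrable_inverse_power_norm:
  "integrable lborel (\<lambda>x::'a::euclidean_space. inverse ((1 + norm x) ^ (2 * DIM('a))))"
proof (rule Bochner_Integration.integrable_bound)
  interpret product_sigma_finite "\<lambda>_::'a. lborel :: real measure"
    by standard
  have 1: "integrable lborel (\<lambda>x::real. inverse (1 + x\<^sup>2))"
    using integrable_inverse_1_plus_square by (simp add: set_integrable_def)
  have "integrable (\<Pi>\<^sub>M b\<in>(Basis :: 'a set). lborel) (\<lambda>x. \<Prod>b\<in>Basis. inverse (1 + (x b :: real)\<^sup>2))"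
    by (rule product_integrable_prod) (use 1 in auto)
  then show "integrable lborel (\<lambda>x::'a. \<Prod>b\<in>Basis. inverse (1 + (x \<bullet> b)\<^sup>2))"
    by (subst lborel_eq, subst integrable_distr_eq) auto
  show "AE x::'a in lborel. norm (inverse ((1 + norm x) ^ (2 * DIM('a))))
      \<le> norm (\<Prod>b\<in>Basis. inverse (1 + (x \<bullet> b)\<^sup>2))"
  proof (rule AE_I2)
    fix x :: 'a
    have "(\<Prod>b\<in>(Basis :: 'a set). 1 + (x \<bullet> b)\<^sup>2) \<le> (\<Prod>b\<in>(Basis :: 'a set). (1 + norm x)\<^sup>2)"
    proof (rule prod_mono)
      fix b :: 'a assume b: "b \<in> Basis"
      have "(x \<bullet> b)\<^sup>2 \<le> (norm x)\<^sup>2"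
        using Basis_le_norm[OF b, of x] by (metis abs_norm_cancel abs_le_square_iff)
      then have "1 + (x \<bullet> b)\<^sup>2 \<le> (1 + norm x)\<^sup>2"
        using norm_ge_zero[of x] by (simp add: power2_eq_square algebra_simps del: norm_ge_zero)
      then show "0 \<le> 1 + (x \<bullet> b)\<^sup>2 \<and> 1 + (x \<bullet> b)\<^sup>2 \<le> (1 + norm x)\<^sup>2" by simp
    qed
    also have "\<dots> = (1 + norm x) ^ (2 * DIM('a))"
      by (simp add: power_mult)
    finally have "inverse ((1 + norm x) ^ (2 * DIM('a))) \<le> inverse (\<Prod>b\<in>(Basis :: 'a set). 1 + (x \<bullet> b)\<^sup>2)"
      by (intro le_imp_inverse_le prod_pos) (simp_all add: add_pos_nonneg)
    then show "norm (inverse ((1 + norm x) ^ (2 * DIM('a))))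
      \<le> norm (\<Prod>b\<in>Basis. inverse (1 + (x \<bullet> b)\<^sup>2))"
      by (simp add: prod_inversef[symmetric] abs_prod power_abs prod_nonneg)
  qed
qed simp

section \<open>Schwartz functions: continuity, derivatives, decay and integrability\<close>

lemma smooth_imp_continuous:
  assumes "smooth g"
  shows "continuous_on UNIV g"
proof -
  have "g differentiable (at x)" for x
    using assms unfolding smooth_def by (metis iterated_deriv.simps(1) lists.Nil)
  then show ?thesis
    by (simp add: differentiable_imp_continuous_within continuous_at_imp_continuous_on)
qed

lemma schwartz_continuous: "schwartz g \<Longrightarrow> continuous_on UNIV g"
  by (simp add: schwartz_def smooth_imp_continuous)

lemma schwartz_measurable [measurable_dest]: "schwartz g \<Longrightarrow> g \<in> borel_measurable borel"
  by (rule borel_measurable_continuous_onI[OF schwartz_continuous])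

lemma iterated_deriv_append:
  "iterated_deriv bs (iterated_deriv cs g) = iterated_deriv (bs @ cs) g"
  by (induction bs) auto

lemma schwartz_partial_deriv:
  assumes g: "schwartz g" and b: "b \<in> Basis"
  shows "schwartz (partial_deriv b g)"
proof -
  have "iterated_deriv bs (partial_deriv b g) = iterated_deriv (bs @ [b]) g" for bs
    using iterated_deriv_append[of bs "[b]" g] by simp
  moreover have "bs @ [b] \<in> lists Basis" if "bs \<in> lists Basis" for bs
    using that b by auto
  ultimately show ?thesis
    using g unfolding schwartz_def smooth_def by simp
qed

lemma norm_le_decay:
  assumes "\<And>x. (1 + norm x) ^ k * norm (g x) \<le> M"
  shows "norm (g x) \<le> M * inverse ((1 + norm x) ^ k)"
proof -
  have "0 < (1 + norm x) ^ k"
    by (intro zero_less_power) (simp add: add_pos_nonneg)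
  then show ?thesis
    using assms[of x] by (simp add: field_simps)
qed

lemma schwartz_integrable:
  fixes g :: "'a::euclidean_space \<Rightarrow> complex"
  assumes g: "schwartz g"
  shows "integrable lborel g"
proof -
  have "bounded (range (\<lambda>x. (1 + norm x) ^ (2 * DIM('a)) *\<^sub>R iterated_deriv [] g x))"
    using g unfolding schwartz_def by blast
  then obtain M where M: "\<And>x. norm ((1 + norm x) ^ (2 * DIM('a)) *\<^sub>R g x) \<le> M"
    unfolding bounded_iff by auto
  have M': "(1 + norm x) ^ (2 * DIM('a)) * norm (g x) \<le> M" for x
    using M[of x] by (simp add: power_abs)
  show ?thesis
  proof (rule Bochner_Integration.integrable_bound)
    show "integrable lborel (\<lambda>x::'a. M * inverse ((1 + norm x) ^ (2 * DIM('a))))"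
      by (intro integrable_mult_right integrable_inverse_power_norm)
    show "g \<in> borel_measurable lborel" using schwartz_measurable[OF g] by simp
    show "AE x in lborel. norm (g x) \<le> norm (M * inverse ((1 + norm x) ^ (2 * DIM('a))))"
    proof (rule AE_I2)
      fix x
      show "norm (g x) \<le> norm (M * inverse ((1 + norm x) ^ (2 * DIM('a))))"
        unfolding real_norm_def by (rule order_trans[OF norm_le_decay[OF M'] abs_ge_self])
    qed
  qed
qed

lemma bounded_mult_schwartz_integrable:
  fixes f g :: "'a::euclidean_space \<Rightarrow> complex"
  assumes f: "continuous_on UNIV f" "\<And>x. norm (f x) \<le> B" and g: "schwartz g"
  shows "integrable lborel (\<lambda>x. f x * g x)"
proof (rule Bochner_Integration.integrable_bound)
  show "integrable lborel (\<lambda>x. B * norm (g x))"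
    by (intro integrable_mult_right integrable_norm schwartz_integrable g)
  have [measurable]: "f \<in> borel_measurable borel" "g \<in> borel_measurable borel"
    using f(1) g by (auto intro: borel_measurable_continuous_onI schwartz_continuous)
  show "(\<lambda>x. f x * g x) \<in> borel_measurable lborel" by simp
  show "AE x in lborel. norm (f x * g x) \<le> norm (B * norm (g x))"
  proof (rule AE_I2)
    fix x
    have "norm (f x * g x) \<le> B * norm (g x)"
      unfolding norm_mult by (intro mult_right_mono f) auto
    then show "norm (f x * g x) \<le> norm (B * norm (g x))"
      unfolding real_norm_def by (rule order_trans[OF _ abs_ge_self])
  qed
qed

text \<open>Only the seminorm without derivatives enters: with weight \<open>2 * DIM('a)\<close> it
  dominates the test function by an integrable one. \<open>K\<close> is \<open>B\<close> times the
  integral of that decay function.\<close>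

lemma tempered_distribution_dist_of_fun:
  fixes f :: "'a::euclidean_space \<Rightarrow> complex"
  assumes f: "continuous_on UNIV f" "\<And>x. norm (f x) \<le> B"
  shows "tempered_distribution (dist_of_fun f)"
  unfolding tempered_distribution_def
proof (intro conjI allI impI)
  fix g h :: "'a \<Rightarrow> complex" assume "schwartz g" "schwartz h"
  then show "dist_of_fun f (\<lambda>x. g x + h x) = dist_of_fun f g + dist_of_fun f h"
    unfolding dist_of_fun_def
    by (simp add: distrib_left bounded_mult_schwartz_integrable[OF f])
next
  fix c and g :: "'a \<Rightarrow> complex"
  show "dist_of_fun f (\<lambda>x. c * g x) = c * dist_of_fun f g"
    unfolding dist_of_fun_def by (simp add: mult.left_commute)
next
  let ?D = "\<lambda>x::'a. inverse ((1 + norm x) ^ (2 * DIM('a)))"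
  have "norm (dist_of_fun f g) \<le> (B * (LINT x|lborel. ?D x)) * M"
    if g: "schwartz g" and M: "\<forall>bs\<in>lists Basis. length bs \<le> 2 * DIM('a) \<longrightarrow>
        (\<forall>x. (1 + norm x) ^ (2 * DIM('a)) * norm (iterated_deriv bs g x) \<le> M)" for g M
  proof -
    have M': "(1 + norm x) ^ (2 * DIM('a)) * norm (g x) \<le> M" for x
      using M[rule_format, of "[]"] by simp
    have B: "0 \<le> B"
      using order_trans[OF norm_ge_zero f(2)] .
    have "norm (f x * g x) \<le> B * (M * ?D x)" for x
      unfolding norm_mult by (intro mult_mono f norm_le_decay[OF M'] B) auto
    then have "norm (dist_of_fun f g) \<le> (LINT x|lborel. B * (M * ?D x))"
      unfolding dist_of_fun_def
      by (intro Bochner_Integration.integral_norm_bound_integral bounded_mult_schwartz_integrable[OF f] g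
          integrable_mult_right integrable_inverse_power_norm)
    then show ?thesis by (simp add: mult_ac)
  qed
  then show "\<exists>K N. \<forall>g M. schwartz g \<longrightarrow>
        (\<forall>bs\<in>lists Basis. length bs \<le> N \<longrightarrow>
           (\<forall>x::'a. (1 + norm x) ^ N * norm (iterated_deriv bs g x) \<le> M)) \<longrightarrow>
        norm (dist_of_fun f g) \<le> K * M" by blast
qed

section \<open>Convolution of bounded functions with Schwartz functions\<close>

lemma lborel_distr_reflect: "distr lborel borel (\<lambda>y. x - y) = (lborel :: 'a::euclidean_space measure)"
  by (subst lborel_affine[of "-1" x]) (auto simp: density_1)

text \<open>The substitution of \<open>x - y\<close> for \<open>y\<close> moves the translation onto
  \<open>f\<close>, where a uniform bound absorbs it.\<close>

lemma dist_convolution_dist_of_fun: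
  fixes f g :: "'a::euclidean_space \<Rightarrow> complex"
  assumes [measurable]: "f \<in> borel_measurable borel" "g \<in> borel_measurable borel"
  shows "dist_convolution (dist_of_fun f) g x = (LINT y|lborel. f (x - y) * g y)"
proof -
  have "dist_convolution (dist_of_fun f) g x = (LINT y|distr lborel borel (\<lambda>y. x - y). f y * g (x - y))"
    unfolding dist_convolution_def dist_of_fun_def lborel_distr_reflect ..
  also have "\<dots> = (LINT y|lborel. f (x - y) * g y)"
    by (subst integral_distr) auto
  finally show ?thesis .
qed

text \<open>Young's inequality for a bounded and an integrable function.\<close>

lemma norm_dist_convolution_le:
  fixes f g :: "'a::euclidean_space \<Rightarrow> complex"
  assumes f: "continuous_on UNIV f" "\<And>x. norm (f x) \<le> B" and g: "schwartz g"
  shows "norm (dist_convolution (dist_of_fun f) g x) \<le> B * (LINT y|lborel. norm (g y))"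
proof -
  have m: "f \<in> borel_measurable borel" "g \<in> borel_measurable borel"
    using f(1) g by (auto intro: borel_measurable_continuous_onI schwartz_continuous)
  have "norm (LINT y|lborel. f (x - y) * g y) \<le> (LINT y|lborel. B * norm (g y))"
  proof (rule Bochner_Integration.integral_norm_bound_integral)
    show "integrable lborel (\<lambda>y. f (x - y) * g y)"
      by (rule bounded_mult_schwartz_integrable[where B = B])
        (auto intro!: continuous_intros continuous_on_compose2[OF f(1)] f(2) g)
    show "integrable lborel (\<lambda>y. B * norm (g y))"
      by (intro integrable_mult_right integrable_norm schwartz_integrable g)
    show "norm (f (x - y) * g y) \<le> B * norm (g y)" for y
      unfolding norm_mult by (intro mult_right_mono f) auto
  qed
  then show ?thesis
    by (simp add: dist_convolution_dist_of_fun[OF m])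
qed

section \<open>Besov norms of trigonometric polynomials\<close>

text \<open>Only the location of the frequencies is recorded, not their number or the coefficients:
  besides a sup bound, the Besov estimate depends on nothing else.\<close>

definition trig_poly :: "'a::euclidean_space set \<Rightarrow> ('a \<Rightarrow> complex) \<Rightarrow> bool" where
  "trig_poly S f \<longleftrightarrow> (\<exists>I c. finite I \<and> I \<subseteq> S \<and> f = (\<lambda>x. \<Sum>t\<in>I. c t * cis (x \<bullet> t)))"

lemma trig_poly_monomial: "t \<in> S \<Longrightarrow> trig_poly S (\<lambda>x. c * cis (x \<bullet> t))"
  unfolding trig_poly_def by (intro exI[of _ "{t}"] exI[of _ "\<lambda>_. c"]) auto

lemma trig_poly_zero: "trig_poly S (\<lambda>x. 0)"
  unfolding trig_poly_def by (intro exI[of _ "{}"]) auto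

lemma trig_poly_add:
  assumes "trig_poly S f" "trig_poly S g"
  shows "trig_poly S (\<lambda>x. f x + g x)"
proof -
  obtain I c where I: "finite I" "I \<subseteq> S" "f = (\<lambda>x. \<Sum>t\<in>I. c t * cis (x \<bullet> t))"
    using assms(1) unfolding trig_poly_def by blast
  obtain J d where J: "finite J" "J \<subseteq> S" "g = (\<lambda>x. \<Sum>t\<in>J. d t * cis (x \<bullet> t))"
    using assms(2) unfolding trig_poly_def by blast
  have ext: "(\<Sum>t\<in>A. a t * cis (x \<bullet> t)) = (\<Sum>t\<in>I \<union> J. (if t \<in> A then a t else 0) * cis (x \<bullet> t))"
    if "A \<subseteq> I \<union> J" for A a and x :: 'a
    using that I(1) J(1) by (intro sum.mono_neutral_cong_left) auto
  have "(\<lambda>x. f x + g x) =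
      (\<lambda>x. \<Sum>t\<in>I \<union> J. ((if t \<in> I then c t else 0) + (if t \<in> J then d t else 0)) * cis (x \<bullet> t))"
    unfolding I(3) J(3) by (simp add: ext[of I] ext[of J] sum.distrib[symmetric] distrib_right)
  then show ?thesis
    unfolding trig_poly_def using I(1,2) J(1,2)
    by (intro exI[of _ "I \<union> J"] exI[of _ "\<lambda>t. (if t \<in> I then c t else 0) + (if t \<in> J then d t else 0)"]) auto
qed

lemma trig_poly_sum:
  assumes "\<And>i. i \<in> A \<Longrightarrow> trig_poly S (f i)"
  shows "trig_poly S (\<lambda>x. \<Sum>i\<in>A. f i x)"
  using assms by (induction A rule: infinite_finite_induct) (auto intro: trig_poly_zero trig_poly_add)

lemma trig_poly_mono: "trig_poly S f \<Longrightarrow> S \<subseteq> T \<Longrightarrow> trig_poly T f"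
  unfolding trig_poly_def by blast

text \<open>Characters multiply by adding frequencies. Different pairs may have the same sum, so the
  double sum is reassembled from monomials instead of being indexed by the sums.\<close>

lemma trig_poly_mult:
  assumes "trig_poly S f" "trig_poly T g"
  shows "trig_poly {s + t |s t. s \<in> S \<and> t \<in> T} (\<lambda>x. f x * g x)"
proof -
  obtain I c where I: "I \<subseteq> S" "f = (\<lambda>x. \<Sum>s\<in>I. c s * cis (x \<bullet> s))"
    using assms(1) unfolding trig_poly_def by blast
  obtain J d where J: "J \<subseteq> T" "g = (\<lambda>x. \<Sum>t\<in>J. d t * cis (x \<bullet> t))"
    using assms(2) unfolding trig_poly_def by blast
  have "(\<lambda>x. f x * g x) = (\<lambda>x. \<Sum>s\<in>I. \<Sum>t\<in>J. (c s * d t) * cis (x \<bullet> (s + t)))"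
    unfolding I(2) J(2) sum_product by (simp add: inner_add_right mult_ac flip: cis_mult)
  then show ?thesis
    using I(1) J(1) by (auto intro!: trig_poly_sum trig_poly_monomial)
qed

lemma trig_poly_cmult:
  assumes "trig_poly S f"
  shows "trig_poly S (\<lambda>x. c * f x)"
proof -
  have "trig_poly {0} (\<lambda>x. c)"
    using trig_poly_monomial[of 0 "{0}" c] by simp
  from trig_poly_mult[OF this assms] show ?thesis by simp
qed

lemma fourier_cis: "fourier g t = (LINT x|lborel. g x * cis (- (x \<bullet> t)))"
  unfolding fourier_def cis_conv_exp by (simp add: mult.commute)

text \<open>Characters are eigenfunctions of convolution, and the eigenvalue is the Fourier
  transform of the kernel at the frequency.\<close>

lemma dist_convolution_trig_poly:
  fixes g :: "'a::euclidean_space \<Rightarrow> complex"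
  assumes g: "schwartz g" and I: "finite I"
  shows "dist_convolution (dist_of_fun (\<lambda>x. \<Sum>t\<in>I. c t * cis (x \<bullet> t))) g x =
    (\<Sum>t\<in>I. c t * fourier g t * cis (x \<bullet> t))"
proof -
  have "(\<lambda>x::'a. \<Sum>t\<in>I. c t * cis (x \<bullet> t)) \<in> borel_measurable borel"
    by (intro borel_measurable_continuous_onI continuous_intros)
  then have "dist_convolution (dist_of_fun (\<lambda>x. \<Sum>t\<in>I. c t * cis (x \<bullet> t))) g x =
      (LINT y|lborel. (\<Sum>t\<in>I. c t * cis ((x - y) \<bullet> t)) * g y)"
    using g by (simp add: dist_convolution_dist_of_fun schwartz_measurable)
  also have "\<dots> = (LINT y|lborel. (\<Sum>t\<in>I. c t * cis (x \<bullet> t) * (cis (- (y \<bullet> t)) * g y)))"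
  proof -
    have "c t * cis ((x - y) \<bullet> t) * g y = c t * cis (x \<bullet> t) * (cis (- (y \<bullet> t)) * g y)" for t y
    proof -
      have "cis ((x - y) \<bullet> t) = cis (x \<bullet> t) * cis (- (y \<bullet> t))"
        by (simp add: cis_mult inner_diff_left)
      then show ?thesis by (simp only: mult.assoc)
    qed
    then show ?thesis by (simp only: sum_distrib_right)
  qed
  also have "\<dots> = (\<Sum>t\<in>I. c t * cis (x \<bullet> t) * (LINT y|lborel. cis (- (y \<bullet> t)) * g y))"
  proof (subst Bochner_Integration.integral_sum)
    fix t
    have "integrable lborel (\<lambda>y. cis (- (y \<bullet> t)) * g y)"
      by (rule bounded_mult_schwartz_integrable[where B = 1]) (auto intro!: continuous_intros g)
    then show "integrable lborel (\<lambda>y. c t * cis (x \<bullet> t) * (cis (- (y \<bullet> t)) * g y))"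
      by (rule integrable_mult_right)
  qed simp
  finally show ?thesis
    by (simp add: fourier_cis mult_ac)
qed

section \<open>The dyadic partition of unity\<close>

lemma besov_cutoff_eq_0:
  assumes "besov_cutoff w" "s \<le> 1/2 \<or> 2 \<le> s"
  shows "w s = 0"
proof -
  have z: "w s = 0" if "s \<notin> {1/2..2}" for s
    using assms(1) that closure_subset[of "{s. w s \<noteq> 0}"] unfolding besov_cutoff_def by blast
  have c: "continuous_on A w" for A
    using assms(1) smooth_imp_continuous[of w] continuous_on_subset unfolding besov_cutoff_def by blast
  \<comment> \<open>The support condition says nothing about the endpoints \<open>1/2\<close> and
    \<open>2\<close> themselves; continuity extends the zero values to them.\<close>
  have "w s = 0" if "s \<in> closure {..<1/2}"
    using continuous_constant_on_closure[OF c _ that, of 0] z by auto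
  moreover have "w s = 0" if "s \<in> closure {2<..}"
    using continuous_constant_on_closure[OF c _ that, of 0] z by auto
  ultimately show ?thesis using assms(2) by auto
qed

text \<open>If \<open>k\<close> is the integer part of \<open>log 2 s\<close>, only
  \<open>n = k\<close> and \<open>n = k + 1\<close> can contribute, and the identity for
  \<open>w\<close> on \<open>{1..2}\<close>, taken at \<open>s / 2 powi k\<close>, makes these two
  terms add up to \<open>1\<close>. As \<open>k\<close> may equal \<open>hi\<close>, the range ends
  at \<open>hi + 1\<close>.\<close>

lemma
  assumes w: "besov_cutoff w" and s: "2 powi lo \<le> s" "s \<le> 2 powi hi"
  shows besov_cutoff_dyadic_0: "n \<notin> {lo..hi + 1} \<Longrightarrow> w (s / 2 powi n) = 0"
    and besov_cutoff_dyadic_sum: "(\<Sum>n\<in>{lo..hi + 1}. w (s / 2 powi n)) = 1"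
proof -
  have s0: "0 < s"
    using s(1) zero_less_power_int[of "2::real" lo] by linarith
  define k where "k = \<lfloor>log 2 s\<rfloor>"
  have "2 powr real_of_int k \<le> s" "s < 2 powr real_of_int (k + 1)"
    unfolding k_def using s0 by (simp_all add: powr_le_iff less_powr_iff)
  then have k: "2 powi k \<le> s" "s < 2 powi (k + 1)"
    using powr_real_of_int'[of 2 k] powr_real_of_int'[of 2 "k + 1"] by simp_all
  have klo: "lo \<le> k"
  proof (rule ccontr)
    assume "\<not> lo \<le> k"
    then have "2 powi (k + 1) \<le> (2::real) powi lo"
      by (intro power_int_increasing) auto
    then show False using k s by linarith
  qed
  have khi: "k \<le> hi"
  proof (rule ccontr)
    assume "\<not> k \<le> hi"
    then have "2 powi hi < (2::real) powi k"
      by (intro power_int_strict_increasing) auto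
    then show False using k s by linarith
  qed
  have z: "w (s / 2 powi n) = 0" if "n \<notin> {k, k + 1}" for n
  proof (rule besov_cutoff_eq_0[OF w])
    consider "n \<le> k - 1" | "k + 2 \<le> n" using \<open>n \<notin> {k, k + 1}\<close> by force
    then show "s / 2 powi n \<le> 1 / 2 \<or> 2 \<le> s / 2 powi n"
    proof cases
      case 1
      have "2 powi (n + 1) \<le> (2::real) powi k"
        using 1 by (intro power_int_increasing) auto
      then have "2 * 2 powi n \<le> s"
        using k by (simp add: power_int_add)
      then show ?thesis by (simp add: field_simps)
    next
      case 2
      have "2 powi (k + 1) \<le> (2::real) powi (n - 1)"
        using 2 by (intro power_int_increasing) auto
      then have "2 * s \<le> 2 powi n"
        using k by (simp add: power_int_diff)
      then show ?thesis by (simp add: field_simps)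
    qed
  qed
  show "n \<notin> {lo..hi + 1} \<Longrightarrow> w (s / 2 powi n) = 0"
    using z klo khi by force
  have "(\<Sum>n\<in>{lo..hi + 1}. w (s / 2 powi n)) = (\<Sum>n\<in>{k, k + 1}. w (s / 2 powi n))"
    using klo khi z by (intro sum.mono_neutral_right) auto
  also have "\<dots> = w (s / 2 powi k) + w (s / 2 powi k / 2)"
    by (simp add: power_int_add)
  also have "\<dots> = 1"
  proof -
    have "s / 2 powi k \<in> {1..2}"
      using k by (simp add: field_simps power_int_add)
    then show ?thesis using w unfolding besov_cutoff_def by force
  qed
  finally show "(\<Sum>n\<in>{lo..hi + 1}. w (s / 2 powi n)) = 1" .
qed

text \<open>Frequencies in a fixed annulus meet only the dyadic pieces from \<open>lo\<close> to
  \<open>hi + 1\<close>, and each piece inherits a sup bound from \<open>f\<close> by Young's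
  inequality.\<close>

lemma besov_trig_poly:
  fixes W :: "int \<Rightarrow> 'a::euclidean_space \<Rightarrow> complex"
  assumes w: "besov_cutoff w" and W: "besov_kernels w W"
    and f: "trig_poly {t. 2 powi lo \<le> norm t \<and> norm t \<le> 2 powi hi} f" "\<And>x. norm (f x) \<le> 1"
  shows "besov_norm W (dist_of_fun f) \<le> ennreal (\<Sum>n\<in>{lo..hi + 1}. 2 powi n * (LINT y|lborel. norm (W n y)))"
    and "besov_function W f"
proof -
  obtain I c where I: "finite I" "I \<subseteq> {t. 2 powi lo \<le> norm t \<and> norm t \<le> 2 powi hi}"
    and fI: "f = (\<lambda>x. \<Sum>t\<in>I. c t * cis (x \<bullet> t))"
    using f(1) unfolding trig_poly_def by blast
  have cf: "continuous_on UNIV f"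
    unfolding fI by (intro continuous_intros)
  have sW: "schwartz (W n)" and FW: "fourier (W n) t = complex_of_real (w (norm t / 2 powi n))" for n t
    using W unfolding besov_kernels_def by auto
  define F where "F n = dist_convolution (dist_of_fun f) (W n)" for n
  have F: "F n = (\<lambda>x. \<Sum>t\<in>I. c t * complex_of_real (w (norm t / 2 powi n)) * cis (x \<bullet> t))" for n
    unfolding F_def fI by (simp add: dist_convolution_trig_poly[OF sW I(1)] FW fun_eq_iff)
  have F0: "F n = (\<lambda>x. 0)" if "n \<notin> {lo..hi + 1}" for n
  proof -
    have "w (norm t / 2 powi n) = 0" if "t \<in> I" for t
      using I(2) that by (intro besov_cutoff_dyadic_0[OF w _ _ \<open>n \<notin> {lo..hi + 1}\<close>]) auto
    then show ?thesis unfolding F by simp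
  qed
  \<comment> \<open>A finite decomposition of \<open>f\<close> itself, which turns the required
    convergence of the derivative series into a finite sum.\<close>
  have Fsum: "(\<Sum>n\<in>{lo..hi + 1}. F n x) = f x" for x
  proof -
    have "(\<Sum>n\<in>{lo..hi + 1}. F n x) =
        (\<Sum>t\<in>I. c t * complex_of_real (\<Sum>n\<in>{lo..hi + 1}. w (norm t / 2 powi n)) * cis (x \<bullet> t))"
      unfolding F of_real_sum sum_distrib_left sum_distrib_right by (rule sum.swap)
    also have "\<dots> = (\<Sum>t\<in>I. c t * cis (x \<bullet> t))"
      using I(2) by (intro sum.cong refl) (subst besov_cutoff_dyadic_sum[OF w], auto)
    finally show ?thesis unfolding fI .
  qed
  have Fb: "norm (F n x) \<le> (LINT y|lborel. norm (W n y))" for n x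
    using norm_dist_convolution_le[OF cf f(2) sW, of n x] by (simp add: F_def)
  have Fc: "continuous_on UNIV (F n)" for n
    unfolding F by (intro continuous_intros)
  have L: "Linfty_norm (F n) \<le> ennreal (LINT y|lborel. norm (W n y))" for n
  proof -
    have [measurable]: "F n \<in> borel_measurable borel"
      by (rule borel_measurable_continuous_onI[OF Fc])
    show ?thesis
      unfolding Linfty_norm_def by (rule esssup_I) (auto intro!: AE_I2 ennreal_leI Fb)
  qed
  have L0: "Linfty_norm (F n) = 0" if "n \<notin> {lo..hi + 1}" for n
  proof -
    have "Linfty_norm (F n) \<le> 0"
      unfolding Linfty_norm_def F0[OF that] by (rule esssup_I) auto
    then show ?thesis by simp
  qed
  have "besov_norm W (dist_of_fun f) = (\<Sum>n\<in>{lo..hi + 1}. ennreal (2 powi n) * Linfty_norm (F n))"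
    unfolding besov_norm_def F_def[symmetric]
    by (subst infsum_cong_neutral[where T = "{lo..hi + 1}"]) (auto simp: L0)
  also have "\<dots> \<le> (\<Sum>n\<in>{lo..hi + 1}. ennreal (2 powi n) * ennreal (LINT y|lborel. norm (W n y)))"
    by (intro sum_mono mult_left_mono L) auto
  also have "\<dots> = ennreal (\<Sum>n\<in>{lo..hi + 1}. 2 powi n * (LINT y|lborel. norm (W n y)))"
    by (simp add: ennreal_mult[symmetric])
  finally show norm_le: "besov_norm W (dist_of_fun f) \<le>
      ennreal (\<Sum>n\<in>{lo..hi + 1}. 2 powi n * (LINT y|lborel. norm (W n y)))" .
  show "besov_function W f"
    unfolding besov_function_def besov_distribution_def
  proof (intro conjI allI impI ballI)
    show "continuous_on UNIV f" by (rule cf)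
    show "integrable lborel (\<lambda>x. f x * g x)" if "schwartz g" for g
      by (rule bounded_mult_schwartz_integrable[OF cf f(2) that])
    show "tempered_distribution (dist_of_fun f)"
      by (rule tempered_distribution_dist_of_fun[OF cf f(2)])
    show "besov_norm W (dist_of_fun f) < \<infinity>"
      using norm_le by (rule order.strict_trans1) simp
    fix b :: 'a and g :: "'a \<Rightarrow> complex" assume b: "b \<in> Basis" and g: "schwartz g"
    let ?g = "partial_deriv b g"
    have sg: "schwartz ?g" by (rule schwartz_partial_deriv[OF g b])
    have "((\<lambda>n. dist_deriv b (dist_of_fun (F n)) g) has_sum dist_deriv b (dist_of_fun f) g) UNIV"
    proof (rule has_sum_finite_neutralI[where B = "{lo..hi + 1}"])
      show "dist_deriv b (dist_of_fun (F n)) g = 0" if "n \<in> UNIV - {lo..hi + 1}" for n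
        using that by (simp add: F0 dist_deriv_def dist_of_fun_def)
      have "dist_of_fun f ?g = (LINT x|lborel. (\<Sum>n\<in>{lo..hi + 1}. F n x * ?g x))"
        by (simp add: dist_of_fun_def Fsum flip: sum_distrib_right)
      also have "\<dots> = (\<Sum>n\<in>{lo..hi + 1}. dist_of_fun (F n) ?g)"
        unfolding dist_of_fun_def
        by (intro Bochner_Integration.integral_sum bounded_mult_schwartz_integrable[OF Fc Fb sg])
      finally show "dist_deriv b (dist_of_fun f) g = (\<Sum>n\<in>{lo..hi + 1}. dist_deriv b (dist_of_fun (F n)) g)"
        by (simp add: dist_deriv_def sum_negf)
    qed auto
    then show "((\<lambda>n. dist_deriv b (dist_of_fun (dist_convolution (dist_of_fun f) (W n))) g)
        has_sum dist_deriv b (dist_of_fun f) g) UNIV"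
      unfolding F_def .
  qed
qed

section \<open>Interpolation with Fejer kernels\<close>

text \<open>A geometric series whose ratio \<open>z\<close> satisfies \<open>z ^ M = 1\<close>. The
  bound on \<open>d\<close> leaves \<open>0\<close> as the only multiple of \<open>M\<close>, so
  \<open>z \<noteq> 1\<close> otherwise.\<close>

lemma sum_cis_roots_of_unity:
  assumes "\<bar>d\<bar> < int M"
  shows "(\<Sum>j<M. cis (2 * pi * of_int d * real j / real M)) = (if d = 0 then of_nat M else 0)"
proof (cases "d = 0")
  case False
  define z where "z = cis (2 * pi * of_int d / real M)"
  have M: "real M > 0" using assms by auto
  have "z \<noteq> 1"
  proof
    assume "z = 1"
    then obtain n :: int where "2 * pi * of_int d / real M = 2 * pi * of_int n"
      unfolding z_def cis_conv_exp exp_eq_1 by (auto simp: mult_ac)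
    then have "real_of_int d = of_int (n * int M)"
      using M by (simp add: field_simps)
    then have "d = n * int M" by linarith
    with False have "n \<noteq> 0" by auto
    then have "1 * int M \<le> \<bar>n\<bar> * int M"
      by (intro mult_right_mono) auto
    then have "int M \<le> \<bar>d\<bar>"
      using \<open>d = n * int M\<close> by (simp add: abs_mult)
    with assms show False by simp
  qed
  have "z ^ M = 1"
  proof -
    have "z ^ M = cis (2 * pi * of_int d)"
      unfolding z_def Complex.DeMoivre using M by (intro arg_cong[of _ _ cis]) simp
    then show ?thesis by simp
  qed
  have "cis (2 * pi * of_int d * real j / real M) = z ^ j" for j
    unfolding z_def Complex.DeMoivre by (simp add: mult_ac)
  then have "(\<Sum>j<M. cis (2 * pi * of_int d * real j / real M)) = (\<Sum>j<M. z ^ j)"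
    by simp
  also have "\<dots> = 0"
    using \<open>z \<noteq> 1\<close> \<open>z ^ M = 1\<close> by (simp add: geometric_sum)
  finally show ?thesis using False by simp
qed simp

text \<open>The squared modulus of an averaged exponential sum. For \<open>M > 0\<close> the period
  is \<open>M\<close> and the value at \<open>0\<close> is \<open>1\<close>.\<close>

definition fejer :: "nat \<Rightarrow> real \<Rightarrow> real" where
  "fejer M x = (cmod (\<Sum>p<M. cis (2 * pi * real p * x / real M)))\<^sup>2 / (real M)\<^sup>2"

lemma fejer_nonneg: "0 \<le> fejer M x"
  by (simp add: fejer_def)

text \<open>Multiplying the exponential sum by its conjugate exhibits the frequencies
  \<open>2 * pi * (p - q) / M\<close>. Both the partition of unity and the frequency bound are read
  off from them.\<close>

lemma fejer_expand:
  "complex_of_real (fejer M x) =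
    (\<Sum>p<M. \<Sum>q<M. cis (2 * pi * (real p - real q) * x / real M)) / (of_nat M)\<^sup>2"
proof -
  have "cis (2 * pi * real p * x / real M) * cis (- (2 * pi * real q * x / real M)) =
      cis (2 * pi * (real p - real q) * x / real M)" for p q
    by (simp add: cis_mult diff_divide_distrib[symmetric]) (simp add: algebra_simps)
  then have "(\<Sum>p<M. cis (2 * pi * real p * x / real M)) * cnj (\<Sum>p<M. cis (2 * pi * real p * x / real M)) =
      (\<Sum>p<M. \<Sum>q<M. cis (2 * pi * (real p - real q) * x / real M))"
    unfolding cnj_sum cis_cnj sum_product by simp
  then show ?thesis
    unfolding fejer_def of_real_divide complex_norm_square by simp
qed

text \<open>At integers the exponential sum runs over roots of unity, which makes the kernel a
  cardinal function for the nodes \<open>0, ..., M - 1\<close>.\<close>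

lemma fejer_diff:
  assumes "j < M" "k < M"
  shows "fejer M (real j - real k) = (if j = k then 1 else 0)"
proof -
  have "(\<Sum>p<M. cis (2 * pi * real p * (real j - real k) / real M)) =
      (\<Sum>p<M. cis (2 * pi * of_int (int j - int k) * real p / real M))"
    by (simp add: mult_ac)
  also have "\<dots> = (if j = k then of_nat M else 0)"
    using assms by (subst sum_cis_roots_of_unity) auto
  finally show ?thesis
    using assms by (simp add: fejer_def)
qed

lemma sum_fejer:
  assumes "0 < M"
  shows "(\<Sum>j<M. fejer M (x - real j)) = 1"
proof -
  have "complex_of_real (\<Sum>j<M. fejer M (x - real j)) =
      (\<Sum>j<M. \<Sum>p<M. \<Sum>q<M. cis (2 * pi * (real p - real q) * (x - real j) / real M)) / (of_nat M)\<^sup>2"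
    by (simp add: fejer_expand sum_divide_distrib)
  also have "(\<Sum>j<M. \<Sum>p<M. \<Sum>q<M. cis (2 * pi * (real p - real q) * (x - real j) / real M)) =
      (\<Sum>p<M. \<Sum>q<M. \<Sum>j<M. cis (2 * pi * (real p - real q) * (x - real j) / real M))"
    by (subst sum.swap) (intro sum.cong refl sum.swap)
  \<comment> \<open>Only the \<open>M\<close> diagonal terms survive, each equal to
    \<open>M\<close>, and together they cancel the normalisation.\<close>
  also have "\<dots> = (\<Sum>p<M. \<Sum>q<M. if p = q then of_nat M else 0)"
  proof (intro sum.cong refl)
    fix p q assume pq: "p \<in> {..<M}" "q \<in> {..<M}"
    have "cis (2 * pi * (real p - real q) * (x - real j) / real M) =
        cis (2 * pi * (real p - real q) * x / real M) * cis (2 * pi * of_int (int q - int p) * real j / real M)" for j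
      by (simp add: cis_mult diff_divide_distrib[symmetric] add_divide_distrib[symmetric]) (simp add: algebra_simps)
    then have "(\<Sum>j<M. cis (2 * pi * (real p - real q) * (x - real j) / real M)) =
        cis (2 * pi * (real p - real q) * x / real M) * (\<Sum>j<M. cis (2 * pi * of_int (int q - int p) * real j / real M))"
      by (simp add: sum_distrib_left)
    also have "\<dots> = (if p = q then of_nat M else 0)"
      using pq by (subst sum_cis_roots_of_unity) auto
    finally show "(\<Sum>j<M. cis (2 * pi * (real p - real q) * (x - real j) / real M)) =
        (if p = q then of_nat M else 0)" .
  qed
  also have "\<dots> = (of_nat M)\<^sup>2"
    by (simp add: power2_eq_square)
  finally show ?thesis
    using assms by (metis divide_self_if of_nat_eq_0_iff of_real_eq_1_iff power_eq_0_iff less_numeral_extra(3))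
qed

text \<open>The difference \<open>p - q\<close> is at most \<open>M\<close> in modulus, which bounds
  the frequencies independently of \<open>M\<close>. The shift \<open>a\<close> changes coefficients
  only.\<close>

lemma trig_poly_fejer:
  "trig_poly {s *\<^sub>R b |s. \<bar>s\<bar> \<le> 2 * pi} (\<lambda>x. complex_of_real (fejer M (x \<bullet> b - a)))"
proof -
  have "complex_of_real (fejer M (x \<bullet> b - a)) = (\<Sum>p<M. \<Sum>q<M.
      (cis (- (2 * pi * (real p - real q) * a / real M)) / (of_nat M)\<^sup>2)
        * cis (x \<bullet> ((2 * pi * (real p - real q) / real M) *\<^sub>R b)))" for x
    by (simp add: fejer_expand sum_divide_distrib cis_mult)
      (simp add: algebra_simps diff_divide_distrib add_divide_distrib)
  moreover have "\<bar>2 * pi * (real p - real q) / real M\<bar> \<le> 2 * pi" if "p < M" "q < M" for p q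
  proof -
    have "\<bar>real p - real q\<bar> \<le> real M" using that by linarith
    then have "2 * pi * (\<bar>real p - real q\<bar> / real M) \<le> 2 * pi * 1"
      using that by (intro mult_left_mono) (simp_all add: divide_le_eq)
    then show ?thesis
      by (simp add: abs_mult)
  qed
  ultimately show ?thesis
    by (simp only:) (intro trig_poly_sum trig_poly_monomial, blast)
qed

text \<open>Euler's formula. The frequencies are exactly \<open>b\<close> and \<open>- b\<close>;
  this factor keeps the product below away from frequency zero.\<close>

lemma trig_poly_sin:
  "trig_poly {s *\<^sub>R b |s. \<bar>s\<bar> = 1} (\<lambda>x. complex_of_real (sin (x \<bullet> b)))"
proof -
  have "complex_of_real (sin (x \<bullet> b)) =
      (1 / (2 * \<i>)) * cis (x \<bullet> (1 *\<^sub>R b)) + (- 1 / (2 * \<i>)) * cis (x \<bullet> (- 1 *\<^sub>R b))" for x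
    by (simp add: complex_eq_iff)
  moreover have "trig_poly {s *\<^sub>R b |s. \<bar>s\<bar> = 1} (\<lambda>x. (1 / (2 * \<i>)) * cis (x \<bullet> (1 *\<^sub>R b)))"
    "trig_poly {s *\<^sub>R b |s. \<bar>s\<bar> = 1} (\<lambda>x. (- 1 / (2 * \<i>)) * cis (x \<bullet> (- 1 *\<^sub>R b)))"
    by (rule trig_poly_monomial, rule CollectI, rule exI[of _ 1], simp)
      (rule trig_poly_monomial, rule CollectI, rule exI[of _ "- 1"], simp)
  ultimately show ?thesis
    by (simp only: trig_poly_add)
qed

text \<open>The phases are those of the transform of order \<open>N\<close>, while the kernels have
  period \<open>Suc N\<close>: the nodes \<open>1, ..., N\<close> leave one node free, namely
  \<open>0\<close>, where the interpolant vanishes.\<close>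

definition dft_interpolant :: "nat \<Rightarrow> real^3 \<Rightarrow> complex" where
  "dft_interpolant N x = (\<Sum>j<N. \<Sum>k<N. cis (2 * pi * real j * real k / real N) *
     (complex_of_real (fejer (Suc N) (x $ 1 - real (Suc j))) *
      (complex_of_real (fejer (Suc N) (x $ 2 - real (Suc k))) * complex_of_real (sin (x $ 3)))))"

text \<open>The third component of every frequency has modulus \<open>1\<close>, which gives the
  lower bound; the triangle inequality gives the upper one.\<close>

lemma trig_poly_dft_interpolant:
  "trig_poly {t. 2 powi 0 \<le> norm t \<and> norm t \<le> 2 powi 5} (dft_interpolant N)"
proof -
  have 1: "trig_poly {t. 2 powi 0 \<le> norm t \<and> norm t \<le> 2 powi 5}
    (\<lambda>x::real^3. complex_of_real (fejer (Suc N) (x \<bullet> axis 1 1 - a)) *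
      (complex_of_real (fejer (Suc N) (x \<bullet> axis 2 1 - b)) * complex_of_real (sin (x \<bullet> axis 3 1))))" for a b
  proof (rule trig_poly_mono[OF trig_poly_mult[OF trig_poly_fejer trig_poly_mult[OF trig_poly_fejer trig_poly_sin]]],
      clarsimp)
    fix r s t :: real assume rst: "\<bar>r\<bar> \<le> 2 * pi" "\<bar>s\<bar> \<le> 2 * pi" "\<bar>t\<bar> = 1"
    let ?v = "r *\<^sub>R axis 1 1 + (s *\<^sub>R axis 2 1 + t *\<^sub>R axis 3 1) :: real^3"
    have "\<bar>?v $ 3\<bar> \<le> norm ?v" by (rule component_le_norm_cart)
    moreover have "?v $ 3 = t" by (simp add: axis_def)
    ultimately have "1 \<le> norm ?v" using rst(3) by simp
    moreover have "norm ?v \<le> \<bar>r\<bar> + (\<bar>s\<bar> + \<bar>t\<bar>)"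
      by (intro order_trans[OF norm_triangle_ineq] add_mono) (simp_all add: norm_axis_1)
    \<comment> \<open>With \<open>pi < 4\<close> the sum stays below \<open>17\<close>, and
      \<open>32\<close> is the next power of two.\<close>
    then have "norm ?v \<le> 32"
      using rst pi_less_4 by linarith
    ultimately show "1 \<le> norm ?v \<and> norm ?v \<le> 32" by blast
  qed
  show ?thesis
    unfolding dft_interpolant_def[abs_def]
    by (intro trig_poly_sum trig_poly_cmult 1[unfolded inner_axis inner_real_def mult_1_right])
qed

lemma norm_dft_interpolant_le: "norm (dft_interpolant N x) \<le> 1"
proof -
  let ?F = "\<lambda>y j. fejer (Suc N) (y - real (Suc j))"
  have F: "(\<Sum>j<N. ?F y j) \<le> 1" for y
  proof -
    \<comment> \<open>The kernels at all \<open>N + 1\<close> nodes sum to \<open>1\<close>;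
      dropping the nonnegative one at the free node \<open>0\<close> leaves at most
      \<open>1\<close>.\<close>
    have "fejer (Suc N) (y - real 0) + (\<Sum>j<N. ?F y j) = 1"
      using sum_fejer[of "Suc N" y] unfolding sum.lessThan_Suc_shift by simp
    then show ?thesis
      using fejer_nonneg[of "Suc N" "y - real 0"] by linarith
  qed
  have "norm (dft_interpolant N x) \<le> (\<Sum>j<N. \<Sum>k<N. ?F (x $ 1) j * ?F (x $ 2) k)"
    unfolding dft_interpolant_def
  proof (intro order_trans[OF norm_sum] sum_mono)
    fix j k
    have "?F (x $ 1) j * (?F (x $ 2) k * \<bar>sin (x $ 3)\<bar>) \<le> ?F (x $ 1) j * (?F (x $ 2) k * 1)"
      by (intro mult_left_mono fejer_nonneg abs_sin_le_one)
    then show "norm (cis (2 * pi * real j * real k / real N) *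
     (complex_of_real (?F (x $ 1) j) * (complex_of_real (?F (x $ 2) k) * complex_of_real (sin (x $ 3)))))
       \<le> ?F (x $ 1) j * ?F (x $ 2) k"
      by (simp add: norm_mult fejer_nonneg)
  qed
  also have "\<dots> = (\<Sum>j<N. ?F (x $ 1) j) * (\<Sum>k<N. ?F (x $ 2) k)"
    by (rule sum_product[symmetric])
  also have "\<dots> \<le> 1 * 1"
    by (intro mult_mono F sum_nonneg fejer_nonneg) auto
  finally show ?thesis by simp
qed

text \<open>In the first two variables \<open>0\<close> is a node different from every
  \<open>Suc j\<close>; in the third, \<open>sin 0 = 0\<close>.\<close>

lemma dft_interpolant_eq_0: "l = 0 \<or> m = 0 \<or> n = 0 \<Longrightarrow> dft_interpolant N (vector [l, m, n]) = 0"
  using fejer_diff[of 0 "Suc N"] unfolding dft_interpolant_def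
  by (intro sum.neutral ballI) (auto simp: vector_3 simp del: of_nat_Suc)

lemma dft_interpolant_grid:
  assumes "j < N" "k < N"
  shows "dft_interpolant N (vector [real (Suc j), real (Suc k), pi / 2]) = cis (2 * pi * real j * real k / real N)"
proof -
  have "dft_interpolant N (vector [real (Suc j), real (Suc k), pi / 2]) =
      (\<Sum>j'<N. \<Sum>k'<N. if k' = k then if j' = j then cis (2 * pi * real j' * real k' / real N) else 0 else 0)"
    unfolding dft_interpolant_def vector_3
    by (intro sum.cong refl) (use assms in \<open>auto simp: fejer_diff simp del: of_nat_Suc\<close>)
  also have "\<dots> = cis (2 * pi * real j * real k / real N)"
    using assms by simp
  finally show ?thesis .
qed

section \<open>The counterexample\<close>

text \<open>Eigenvalues are the nodes \<open>Suc j\<close>, while vectors and phases are indexed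
  from \<open>0\<close>; \<open>C\<close> has a single eigenvector, hence the index type
  \<open>unit\<close>.\<close>

lemma rank_one_triple:
  fixes e :: "nat \<Rightarrow> 'h::chilbert_space"
  assumes e: "orthonormal_on {..<N} e" and N: "0 < N"
  shows "\<exists>(v::'h) u g. orthonormal_on {..<N} g \<and> cinner v v = 1 \<and> norm u = 1 \<and>
    (\<forall>x. fun_of_triple (dft_interpolant N) (diag_op {..<N} (\<lambda>j. real (Suc j)) e)
        (diag_op {..<N} (\<lambda>k. real (Suc k)) g) (diag_op {()} (\<lambda>_. pi / 2) (\<lambda>_. v)) x =
      (complex_of_real (sqrt (real N)) * cinner x v) *\<^sub>C u)"
proof -
  define a where "a j k = cis (2 * pi * real j * real k / real N)" for j k
  define r where "r = complex_of_real (1 / sqrt (real N))"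
  have r: "r * cnj r = 1 / of_nat N" "cnj r = r" "of_nat N * r = complex_of_real (sqrt (real N))"
  proof -
    have "r * cnj r = complex_of_real (1 / (sqrt (real N) * sqrt (real N)))"
      by (simp only: r_def complex_cnj_complex_of_real of_real_mult[symmetric] times_divide_times_eq mult_1)
    also have "sqrt (real N) * sqrt (real N) = real N" by simp
    finally show "r * cnj r = 1 / of_nat N" by simp
    show "cnj r = r" by (simp add: r_def)
    have "of_nat N * r = complex_of_real (real N / sqrt (real N))"
      unfolding r_def by simp
    then show "of_nat N * r = complex_of_real (sqrt (real N))" by (simp add: real_div_sqrt)
  qed
  have aa: "a j k * cnj (a j k) = 1" for j k
    by (simp add: a_def cis_cnj cis_mult)
  \<comment> \<open>The phases enter conjugated, so as to cancel the values \<open>a j k\<close>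
    taken by the interpolant on the grid.\<close>
  define g where "g k = (\<Sum>j<N. (r * cnj (a j k)) *\<^sub>C e j)" for k
  have ge: "cinner (g k) (e j) = r * cnj (a j k)" if "j < N" for j k
    unfolding g_def using that by (simp add: cinner_orthonormal_sum[OF e])
  have g: "orthonormal_on {..<N} g"
    unfolding orthonormal_on_def
  proof (intro ballI)
    fix k l assume kl: "k \<in> {..<N}" "l \<in> {..<N}"
    have "cinner (g k) (g l) = (\<Sum>j<N. r * cnj r * (cnj (a j k) * a j l))"
      unfolding g_def cinner_orthonormal_sums[OF e finite_lessThan] by (simp add: mult_ac)
    \<comment> \<open>Orthogonality of the characters modulo \<open>N\<close>: indices below
      \<open>N\<close> differ by less than \<open>N\<close>.\<close>
    also have "\<dots> = (\<Sum>j<N. r * cnj r * cis (2 * pi * of_int (int l - int k) * real j / real N))"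
    proof -
      have "- (2 * pi * real j * real k / real N) + 2 * pi * real j * real l / real N =
          2 * pi * of_int (int l - int k) * real j / real N" for j
        by (simp add: algebra_simps diff_divide_distrib)
      then show ?thesis
        unfolding a_def cis_cnj cis_mult by (simp only:)
    qed
    also have "\<dots> = r * cnj r * (if int l - int k = 0 then of_nat N else 0)"
      using kl unfolding sum_distrib_left[symmetric]
      by (subst sum_cis_roots_of_unity) auto
    also have "\<dots> = (if k = l then 1 else 0)"
      unfolding r(1) using N by auto
    finally show "cinner (g k) (g l) = (if k = l then 1 else 0)" .
  qed
  \<comment> \<open>An operator whose matrix entries between the two bases are all equal maps
    \<open>v\<close> to a multiple of \<open>u\<close>, the unit vectors with constant
    coordinates.\<close>
  define v where "v = (\<Sum>k<N. r *\<^sub>C g k)"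
  define u where "u = (\<Sum>j<N. r *\<^sub>C e j)"
  have vg: "cinner v (g k) = r" if "k < N" for k
    unfolding v_def using that by (simp add: cinner_orthonormal_sum[OF g])
  have vv: "cinner v v = 1"
    unfolding v_def cinner_orthonormal_sums[OF g finite_lessThan] r(1) using N by simp
  have "cinner u u = 1"
    unfolding u_def cinner_orthonormal_sums[OF e finite_lessThan] r(1) using N by simp
  then have u: "norm u = 1"
    by (rule norm_eq_1_of_cinner)
  have "fun_of_triple (dft_interpolant N) (diag_op {..<N} (\<lambda>j. real (Suc j)) e)
        (diag_op {..<N} (\<lambda>k. real (Suc k)) g) (diag_op {()} (\<lambda>_. pi / 2) (\<lambda>_. v)) x =
      (complex_of_real (sqrt (real N)) * cinner x v) *\<^sub>C u" for x
  proof -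
    have "fun_of_triple (dft_interpolant N) (diag_op {..<N} (\<lambda>j. real (Suc j)) e)
        (diag_op {..<N} (\<lambda>k. real (Suc k)) g) (diag_op {()} (\<lambda>_. pi / 2) (\<lambda>_. v)) x =
      (\<Sum>j<N. \<Sum>k<N. \<Sum>i\<in>{()}. (dft_interpolant N (vector [real (Suc j), real (Suc k), pi / 2]) * cinner x v
        * cinner v (g k) * cinner (g k) (e j)) *\<^sub>C e j)"
      by (rule fun_of_triple_diag_op)
        (use e g vv dft_interpolant_eq_0 in \<open>simp_all add: orthonormal_on_def inj_on_def image_iff del: of_nat_Suc\<close>)
    also have "\<dots> = (\<Sum>j<N. \<Sum>k<N. (cinner x v * (r * cnj r)) *\<^sub>C e j)"
    proof (intro sum.cong refl)
      fix j k assume "j \<in> {..<N}" "k \<in> {..<N}"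
      then have jk: "j < N" "k < N" by auto
      have "a j k * cinner x v * r * (r * cnj (a j k)) = (a j k * cnj (a j k)) * (cinner x v * (r * r))"
        by (simp only: mult_ac)
      then show "(\<Sum>i\<in>{()}. (dft_interpolant N (vector [real (Suc j), real (Suc k), pi / 2]) * cinner x v
        * cinner v (g k) * cinner (g k) (e j)) *\<^sub>C e j) = (cinner x v * (r * cnj r)) *\<^sub>C e j"
        unfolding dft_interpolant_grid[OF jk] a_def[symmetric] vg[OF jk(2)] ge[OF jk(1)] aa r(2) by simp
    qed
    \<comment> \<open>The summand does not depend on \<open>k\<close>, and \<open>N\<close> copies
      of \<open>1 / N\<close> make \<open>1\<close>.\<close>
    also have "\<dots> = (\<Sum>j<N. cinner x v *\<^sub>C e j)"
      unfolding r(1) complex_vector.scale_sum_left[symmetric] using N by simp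
    also have "\<dots> = (complex_of_real (sqrt (real N)) * cinner x v) *\<^sub>C u"
    proof -
      have "complex_of_real (sqrt (real N)) * r = 1"
        unfolding r_def using N by simp
      then show ?thesis
        unfolding u_def complex_vector.scale_sum_right scaleC_scaleC
        by (simp add: mult.assoc mult.left_commute)
    qed
    finally show ?thesis .
  qed
  then show ?thesis using g vv u by blast
qed

theorem theorem4p1:
  fixes p :: ereal
    and w :: "real \<Rightarrow> real"
    and W :: "int \<Rightarrow> real^3 \<Rightarrow> complex"
  assumes "1 \<le> p"
    and "besov_cutoff w"
    and "besov_kernels w W"
    and "infinite_dimensional TYPE('h::chilbert_space)"
  shows "\<not> (\<exists>K>0. \<forall>(A1::'h \<Rightarrow> 'h) B1 C1 A2 B2 C2 f.
            (\<forall>T\<in>{A1, B1, C1, A2, B2, C2}. bounded_operator T \<and> finite_rank T \<and> self_adjoint T) \<longrightarrow>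
            besov_function W f \<longrightarrow>
            schatten_norm p (\<lambda>x. fun_of_triple f A1 B1 C1 x - fun_of_triple f A2 B2 C2 x)
              \<le> K * enn2real (besov_norm W (dist_of_fun f)) *
                Max {schatten_norm p (\<lambda>x. A1 x - A2 x),
                     schatten_norm p (\<lambda>x. B1 x - B2 x),
                     schatten_norm p (\<lambda>x. C1 x - C2 x)})"
proof
  assume "\<exists>K>0. \<forall>(A1::'h \<Rightarrow> 'h) B1 C1 A2 B2 C2 f.
            (\<forall>T\<in>{A1, B1, C1, A2, B2, C2}. bounded_operator T \<and> finite_rank T \<and> self_adjoint T) \<longrightarrow>
            besov_function W f \<longrightarrow>
            schatten_norm p (\<lambda>x. fun_of_triple f A1 B1 C1 x - fun_of_triple f A2 B2 C2 x)
              \<le> K * enn2real (besov_norm W (dist_of_fun f)) *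
                Max {schatten_norm p (\<lambda>x. A1 x - A2 x),
                     schatten_norm p (\<lambda>x. B1 x - B2 x),
                     schatten_norm p (\<lambda>x. C1 x - C2 x)}"
  then obtain K where K: "K > 0" and bound: "\<And>(A1::'h \<Rightarrow> 'h) B1 C1 A2 B2 C2 f.
            (\<forall>T\<in>{A1, B1, C1, A2, B2, C2}. bounded_operator T \<and> finite_rank T \<and> self_adjoint T) \<Longrightarrow>
            besov_function W f \<Longrightarrow>
            schatten_norm p (\<lambda>x. fun_of_triple f A1 B1 C1 x - fun_of_triple f A2 B2 C2 x)
              \<le> K * enn2real (besov_norm W (dist_of_fun f)) *
                Max {schatten_norm p (\<lambda>x. A1 x - A2 x),
                     schatten_norm p (\<lambda>x. B1 x - B2 x),
                     schatten_norm p (\<lambda>x. C1 x - C2 x)}"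
    by blast
  \<comment> \<open>The exponents \<open>0\<close> and \<open>5\<close> are those of the annulus
    containing the frequencies, so \<open>R\<close> does not depend on the \<open>N\<close> chosen
    next.\<close>
  define R where "R = (\<Sum>n\<in>{0..5 + 1}. 2 powi n * (LINT y|lborel. norm (W n y)))"
  have R: "0 \<le> R"
    unfolding R_def by (intro sum_nonneg mult_nonneg_nonneg) auto
  obtain N :: nat where N: "(K * R * (pi / 2))\<^sup>2 < real N"
    using reals_Archimedean2 by blast
  have N0: "0 < N"
    using le_less_trans[OF zero_le_power2 N] by simp
  note bf = besov_trig_poly[OF assms(2,3) trig_poly_dft_interpolant[of N] norm_dft_interpolant_le]
  have E: "enn2real (besov_norm W (dist_of_fun (dft_interpolant N))) \<le> R"
    using enn2real_mono[OF bf(1)] R unfolding R_def by simp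
  obtain e :: "nat \<Rightarrow> 'h" where e: "orthonormal_on {..<N} e"
    using orthonormal_exists[OF assms(4)] by blast
  obtain g and v u :: 'h where g: "orthonormal_on {..<N} g" and v: "cinner v v = 1" and u: "norm u = 1"
    and fun1: "\<And>x. fun_of_triple (dft_interpolant N) (diag_op {..<N} (\<lambda>j. real (Suc j)) e)
        (diag_op {..<N} (\<lambda>k. real (Suc k)) g) (diag_op {()} (\<lambda>_. pi / 2) (\<lambda>_. v)) x =
      (complex_of_real (sqrt (real N)) * cinner x v) *\<^sub>C u"
    using rank_one_triple[OF e N0] by blast
  define A where "A = diag_op {..<N} (\<lambda>j. real (Suc j)) e"
  define B where "B = diag_op {..<N} (\<lambda>k. real (Suc k)) g"
  define C where "C = diag_op {()} (\<lambda>_. pi / 2) (\<lambda>_. v)"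
  \<comment> \<open>The zero operator, written with an empty index set so that the formula for
    diagonal triples applies to it.\<close>
  define Z where "Z = diag_op {} (\<lambda>_::unit. 0) (\<lambda>_. v)"
  have ov: "orthonormal_on {()} (\<lambda>_. v)" and oe: "orthonormal_on {} (\<lambda>_::unit. v)"
    using v by (simp_all add: orthonormal_on_def)
  have "\<forall>T\<in>{A, B, C, A, B, Z}. bounded_operator T \<and> finite_rank T \<and> self_adjoint T"
    unfolding A_def B_def C_def Z_def
    using e g ov oe by (auto intro: bounded_operator_diag_op finite_rank_diag_op self_adjoint_diag_op)
  \<comment> \<open>Only the third operators differ, so the maximum will be the norm of
    \<open>C - Z\<close>, which is \<open>pi / 2\<close> times a projection onto a line.\<close>
  from bound[OF this bf(2)]
  have "schatten_norm p (\<lambda>x. fun_of_triple (dft_interpolant N) A B C x - fun_of_triple (dft_interpolant N) A B Z x)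
      \<le> K * enn2real (besov_norm W (dist_of_fun (dft_interpolant N))) *
        Max {schatten_norm p (\<lambda>x. A x - A x), schatten_norm p (\<lambda>x. B x - B x), schatten_norm p (\<lambda>x. C x - Z x)}" .
  moreover have "fun_of_triple (dft_interpolant N) A B Z x = 0" for x
    unfolding A_def B_def Z_def
    by (subst fun_of_triple_diag_op[OF e _ _ _ g _ _ _ oe])
      (simp_all add: inj_on_def dft_interpolant_eq_0 image_iff del: of_nat_Suc)
  then have "schatten_norm p (\<lambda>x. fun_of_triple (dft_interpolant N) A B C x - fun_of_triple (dft_interpolant N) A B Z x)
      = sqrt (real N)"
    unfolding A_def[symmetric] B_def[symmetric] C_def[symmetric]
    using schatten_norm_rank_one[OF v u assms(1), of "complex_of_real (sqrt (real N))"]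
    by (simp add: fun1[folded A_def B_def C_def])
  moreover have nv: "norm v = 1"
    using v by (rule norm_eq_1_of_cinner)
  have "schatten_norm p (\<lambda>x. C x - Z x) = pi / 2"
    using schatten_norm_rank_one[OF v nv assms(1), of "complex_of_real (pi / 2)"]
    by (simp add: C_def Z_def diag_op_def)
  ultimately have "sqrt (real N) \<le> K * enn2real (besov_norm W (dist_of_fun (dft_interpolant N))) * (pi / 2)"
    by (simp add: schatten_norm_zero)
  also have "\<dots> \<le> K * R * (pi / 2)"
    using K E by (intro mult_right_mono mult_left_mono) auto
  finally have "real N \<le> (K * R * (pi / 2))\<^sup>2"
    by (rule sqrt_le_D)
  with N show False by simp
qed

end
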